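(* Let $\pi:\hat G\to G$ be a double covering whose kernel is a characteristic subgroup of $\hat G$, let $i$ denote the non-trivial element of $\ker\pi$, and let $P=\langle X\mid R\rangle$ be a presentation of $G$ of rank $n$ with $m$ relators. If $\hat G$ has a presentation $P_J$ with $J\in C_2^m$, $J\neq 1$, then $\pi$ is a strong double covering of $G$ if and only if $[P_J]$ is the only presentation class of $\hat G$ (that is, if and only if every $L\in C_2^m$ such that $P_L$ is a presentation of $\hat G$ satisfies $L\in R(C_2^n)J$).
   Context: A double covering of a group $G$ is an epimorphism $\pi:\hat G\to G$ whose kernel has exactly $2$ elements (such a kernel is central). If $\ker\pi$ is a characteristic subgroup of $\hat G$, every $\psi\in \mathrm{Aut}(\hat G)$ induces an automorphism $\psi^\pi$ of $G$ by $\psi^\pi(\pi(\hat g))=\pi(\psi(\hat g))$, and $\zeta^\pi:\mathrm{Aut}(\hat G)\to \mathrm{Aut}(G)$, $\psi\mapsto\psi^\pi$, is a homomorphism; $\pi$ is called strong if $\ker\pi$ is characteristic in $\hat G$ and $\zeta^\pi$ is surjective. Let $P=\langle X\mid R\rangle$ be a presentation of $G$ with $X=(x_1,\dots,x_n)$ (rank $n$) and $R=(r_1,\dots,r_m)$. Write $C_2=\{1,i\}$ with $i^2=1$. For $J=(j_1,\dots,j_m)\in C_2^m$ let $$P_J=\langle x_1,\dots,x_n,i\mid r_k=j_k\ (1\le k\le m),\ i^2=1,\ [i,x_l]=1\ (1\le l\le n)\rangle .$$ Here $J=1$ means $J=(1,\dots,1)$. "$P_J$ is a presentation of $\hat G$"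 means that there is an isomorphism from the group presented by $P_J$ to $\hat G$ carrying the generator $i$ to the non-trivial element $i$ of $\ker \pi$. For $I=(i_1,\dots,i_n)\in C_2^n$ put $R(I)=(r_1(i_1,\dots,i_n),\dots,r_m(i_1,\dots,i_n))\in C_2^m$, and $R(C_2^n)=\{R(I)\mid I\in C_2^n\}$, a subgroup of $C_2^m$. Put $P_J\approx P_L$ iff $L\in R(C_2^n)J$, and let $[P_J]$ be the $\approx$-class of $P_J$; all members of a class present the same group. If $P_J$ is a presentation of $\hat G$, $[P_J]$ is called a presentation class of $\hat G$. *)

theory Defs
  imports "HOL-Algebra.Bij" "HOL-Algebra.Generated_Groups" "HOL-Algebra.Product_Groups"
begin

section \<open>Free groups and presentations\<close>

text \<open>The letter \<open>(x, True)\<close> stands for \<open>x\<close>, the letter \<open>(x, False)\<close> for its formal inverse.\<close>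

type_synonym 'x word = "('x \<times> bool) list"

definition words :: "'x set \<Rightarrow> 'x word set" where
  "words X = lists (X \<times> UNIV)"

definition inv_word :: "'x word \<Rightarrow> 'x word" where
  "inv_word w = rev (map (\<lambda>(x, b). (x, \<not> b)) w)"

inductive free_eq :: "'x set \<Rightarrow> 'x word \<Rightarrow> 'x word \<Rightarrow> bool" for X where
  refl: "w \<in> words X \<Longrightarrow> free_eq X w w"
| sym: "free_eq X u v \<Longrightarrow> free_eq X v u"
| trans: "free_eq X u v \<Longrightarrow> free_eq X v w \<Longrightarrow> free_eq X u w"
| cancel: "u \<in> words X \<Longrightarrow> v \<in> words X \<Longrightarrow> x \<in> X \<Longrightarrow>
    free_eq X (u @ [(x, b), (x, \<not> b)] @ v) (u @ v)"

definition free_rel :: "'x set \<Rightarrow> ('x word \<times> 'x word) set" where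
  "free_rel X = {(u, v). free_eq X u v}"

definition free_class :: "'x set \<Rightarrow> 'x word \<Rightarrow> 'x word set" where
  "free_class X w = free_rel X `` {w}"

definition free_group :: "'x set \<Rightarrow> 'x word set monoid" where
  "free_group X = \<lparr>carrier = words X // free_rel X,
     monoid.mult = (\<lambda>A B. \<Union>a\<in>A. \<Union>b\<in>B. free_class X (a @ b)),
     one = free_class X []\<rparr>"

definition normal_closure :: "('a, 'c) monoid_scheme \<Rightarrow> 'a set \<Rightarrow> 'a set" where
  "normal_closure G S =
     generate G {g \<otimes>\<^bsub>G\<^esub> s \<otimes>\<^bsub>G\<^esub> inv\<^bsub>G\<^esub> g | g s. g \<in> carrier G \<and> s \<in> S}"

text \<open>A presentation is a set of generators with a tuple of relators, given as words.\<close>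

type_synonym 'x presentation = "'x set \<times> 'x word list"

definition relator_closure :: "'x presentation \<Rightarrow> 'x word set set" where
  "relator_closure P =
     normal_closure (free_group (fst P)) (free_class (fst P) ` set (snd P))"

definition presented_group :: "'x presentation \<Rightarrow> 'x word set set monoid" where
  "presented_group P = free_group (fst P) Mod relator_closure P"

definition pres_gen :: "'x presentation \<Rightarrow> 'x \<Rightarrow> 'x word set set" where
  "pres_gen P x = relator_closure P #>\<^bsub>free_group (fst P)\<^esub> free_class (fst P) [(x, True)]"

definition eval_word :: "('a, 'c) monoid_scheme \<Rightarrow> ('x \<Rightarrow> 'a) \<Rightarrow> 'x word \<Rightarrow> 'a" where
  "eval_word G f w =
     foldr (\<lambda>(x, b) a. (if b then f x else inv\<^bsub>G\<^esub> (f x)) \<otimes>\<^bsub>G\<^esub> a) w \<one>\<^bsub>G\<^esub>"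


section \<open>Double coverings\<close>

definition characteristic_subgroup :: "'a set \<Rightarrow> ('a, 'c) monoid_scheme \<Rightarrow> bool" where
  "characteristic_subgroup H G \<longleftrightarrow>
     subgroup H G \<and> (\<forall>\<psi> \<in> carrier (AutoGroup G). \<psi> ` H = H)"

definition double_covering ::
    "('a, 'c) monoid_scheme \<Rightarrow> ('b, 'd) monoid_scheme \<Rightarrow> ('a \<Rightarrow> 'b) \<Rightarrow> bool" where
  "double_covering Gh G \<pi> \<longleftrightarrow>
     group Gh \<and> group G \<and> \<pi> \<in> epi Gh G \<and> card (kernel Gh G \<pi>) = 2"

text \<open>The automorphism \<open>\<psi>\<^sup>\<pi>\<close>; independence of the chosen preimage is \<open>induced_aut_apply\<close> below.\<close>

definition induced_aut ::
    "('a, 'c) monoid_scheme \<Rightarrow> ('b, 'd) monoid_scheme \<Rightarrow> ('a \<Rightarrow> 'b) \<Rightarrow> ('a \<Rightarrow> 'a) \<Rightarrow> 'b \<Rightarrow> 'b" where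
  "induced_aut Gh G \<pi> \<psi> = (\<lambda>g\<in>carrier G. \<pi> (\<psi> (inv_into (carrier Gh) \<pi> g)))"

definition strong_double_covering ::
    "('a, 'c) monoid_scheme \<Rightarrow> ('b, 'd) monoid_scheme \<Rightarrow> ('a \<Rightarrow> 'b) \<Rightarrow> bool" where
  "strong_double_covering Gh G \<pi> \<longleftrightarrow>
     double_covering Gh G \<pi> \<and>
     characteristic_subgroup (kernel Gh G \<pi>) Gh \<and>
     induced_aut Gh G \<pi> ` carrier (AutoGroup Gh) = carrier (AutoGroup G)"


section \<open>Presentations of double coverings\<close>

text \<open>The group \<open>C\<^sub>2 = {1, i}\<close> is the library's additive group \<open>{0, 1}\<close>: its integer \<open>0\<close> is the
  neutral element, its integer \<open>1\<close> is \<open>i\<close>.\<close>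

abbreviation C2 :: "int monoid" where
  "C2 \<equiv> integer_mod_group 2"

abbreviation C2_pow :: "nat \<Rightarrow> (nat \<Rightarrow> int) monoid" where
  "C2_pow k \<equiv> product_group {..<k} (\<lambda>_. C2)"

text \<open>The generators \<open>x\<^sub>1, \<dots>, x\<^sub>n\<close> are the numbers \<open>0, \<dots>, n - 1\<close>. In the presentation of a double
  cover, the number \<open>n\<close> is the additional generator \<open>i\<close>.\<close>

definition C2_word :: "nat \<Rightarrow> int \<Rightarrow> nat word" where
  "C2_word n j = (if j = \<one>\<^bsub>C2\<^esub> then [] else [(n, True)])"

definition comm_word :: "'x \<Rightarrow> 'x \<Rightarrow> 'x word" where
  "comm_word x y = [(x, False), (y, False), (x, True), (y, True)]"

text \<open>A relation \<open>u = v\<close> is the relator \<open>u v\<^sup>-\<^sup>1\<close>.\<close>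

definition cover_pres :: "nat \<Rightarrow> nat word list \<Rightarrow> (nat \<Rightarrow> int) \<Rightarrow> nat presentation" where
  "cover_pres n R J =
     ({..<n} \<union> {n},
      map (\<lambda>k. (R ! k) @ inv_word (C2_word n (J k))) [0..<length R]
      @ [[(n, True), (n, True)]]
      @ map (\<lambda>l. comm_word n l) [0..<n])"

definition is_presentation_of :: "'x presentation \<Rightarrow> ('b, 'd) monoid_scheme \<Rightarrow> bool" where
  "is_presentation_of P G \<longleftrightarrow> presented_group P \<cong> G"

text \<open>\<open>z\<close> is the non-trivial element of the kernel of the covering.\<close>

definition is_cover_presentation_of ::
    "nat \<Rightarrow> nat word list \<Rightarrow> (nat \<Rightarrow> int) \<Rightarrow> ('a, 'c) monoid_scheme \<Rightarrow> 'a \<Rightarrow> bool" where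
  "is_cover_presentation_of n R J Gh z \<longleftrightarrow>
     (\<exists>\<phi> \<in> iso (presented_group (cover_pres n R J)) Gh.
        \<phi> (pres_gen (cover_pres n R J) n) = z)"

definition relator_values :: "nat word list \<Rightarrow> (nat \<Rightarrow> int) \<Rightarrow> nat \<Rightarrow> int" where
  "relator_values R I = (\<lambda>k\<in>{..<length R}. eval_word C2 I (R ! k))"

definition cover_equiv :: "nat \<Rightarrow> nat word list \<Rightarrow> (nat \<Rightarrow> int) \<Rightarrow> (nat \<Rightarrow> int) \<Rightarrow> bool" where
  "cover_equiv n R J L \<longleftrightarrow>
     L \<in> (relator_values R ` carrier (C2_pow n)) #>\<^bsub>C2_pow (length R)\<^esub> J"

definition pres_class :: "nat \<Rightarrow> nat word list \<Rightarrow> (nat \<Rightarrow> int) \<Rightarrow> nat presentation set" where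
  "pres_class n R J =
     {cover_pres n R L | L. L \<in> carrier (C2_pow (length R)) \<and> cover_equiv n R J L}"

definition pres_classes_of ::
    "nat \<Rightarrow> nat word list \<Rightarrow> ('a, 'c) monoid_scheme \<Rightarrow> 'a \<Rightarrow> nat presentation set set" where
  "pres_classes_of n R Gh z =
     {pres_class n R L | L.
        L \<in> carrier (C2_pow (length R)) \<and> is_cover_presentation_of n R L Gh z}"


section \<open>Well-definedness\<close>

lemma words_append [simp]: "u @ v \<in> words X \<longleftrightarrow> u \<in> words X \<and> v \<in> words X"
  by (auto simp: words_def)

lemma words_Nil [simp]: "[] \<in> words X"
  by (simp add: words_def)

lemma words_Cons [simp]: "(x, b) # w \<in> words X \<longleftrightarrow> x \<in> X \<and> w \<in> words X"
  by (auto simp: words_def)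

lemma free_eq_words: "free_eq X u v \<Longrightarrow> u \<in> words X \<and> v \<in> words X"
  by (induction rule: free_eq.induct) auto

lemma free_eq_append_right:
  assumes "free_eq X u v" "w \<in> words X" shows "free_eq X (u @ w) (v @ w)"
  using assms
proof (induction rule: free_eq.induct)
  case (cancel u v x b)
  then show ?case using free_eq.cancel[of u X "v @ w" x b] by simp
next
  case (refl u)
  then show ?case by (simp add: free_eq.refl)
next
  case (sym u v)
  then show ?case by (blast intro: free_eq.sym)
next
  case (trans u v u')
  then show ?case by (blast intro: free_eq.trans)
qed

lemma free_eq_append_left:
  assumes "free_eq X u v" "w \<in> words X" shows "free_eq X (w @ u) (w @ v)"
  using assms
proof (induction rule: free_eq.induct)
  case (cancel u v x b)
  then show ?case using free_eq.cancel[of "w @ u" X v x b] by simp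
next
  case (refl u)
  then show ?case by (simp add: free_eq.refl)
next
  case (sym u v)
  then show ?case by (blast intro: free_eq.sym)
next
  case (trans u v u')
  then show ?case by (blast intro: free_eq.trans)
qed

lemma free_eq_append:
  "free_eq X a a' \<Longrightarrow> free_eq X b b' \<Longrightarrow> free_eq X (a @ b) (a' @ b')"
  by (meson free_eq.trans free_eq_append_left free_eq_append_right free_eq_words)

lemma equiv_free_rel: "equiv (words X) (free_rel X)"
proof (rule equivI)
  show "free_rel X \<subseteq> words X \<times> words X"
    by (auto simp: free_rel_def dest: free_eq_words)
  show "refl_on (words X) (free_rel X)"
    by (auto simp: free_rel_def refl_on_def intro: free_eq.refl)
  show "sym (free_rel X)"
    unfolding free_rel_def sym_def by (blast intro: free_eq.sym)
  show "trans (free_rel X)"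
    unfolding free_rel_def trans_def by (blast intro: free_eq.trans)
qed

lemma free_class_eq_iff:
  "u \<in> words X \<Longrightarrow> v \<in> words X \<Longrightarrow> free_class X u = free_class X v \<longleftrightarrow> free_eq X u v"
  using eq_equiv_class_iff[OF equiv_free_rel, of u X v]
  by (simp add: free_class_def free_rel_def)

lemma carrier_free_group: "carrier (free_group X) = free_class X ` words X"
  by (auto simp: free_group_def quotient_def free_class_def)

lemma one_free_group: "\<one>\<^bsub>free_group X\<^esub> = free_class X []"
  by (simp add: free_group_def)

lemma mult_free_group:
  assumes "u \<in> words X" "v \<in> words X"
  shows "free_class X u \<otimes>\<^bsub>free_group X\<^esub> free_class X v = free_class X (u @ v)"
proof -
  have "free_class X (a @ b) = free_class X (u @ v)"
    if "a \<in> free_class X u" "b \<in> free_class X v" for a b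
  proof -
    have "free_eq X u a" "free_eq X v b"
      using that by (auto simp: free_class_def free_rel_def)
    then show ?thesis
      using assms free_eq_append[of X u a v b] free_eq_words[of X]
      by (metis free_class_eq_iff words_append)
  qed
  then have "(\<Union>a\<in>free_class X u. \<Union>b\<in>free_class X v. free_class X (a @ b))
      = (\<Union>a\<in>free_class X u. \<Union>b\<in>free_class X v. free_class X (u @ v))"
    by (intro SUP_cong) simp_all
  moreover have "free_class X u \<noteq> {}" "free_class X v \<noteq> {}"
    using assms by (auto simp: free_class_def free_rel_def intro: free_eq.refl)
  ultimately show ?thesis
    by (simp add: free_group_def)
qed

lemma inv_word_words [simp]: "inv_word w \<in> words X \<longleftrightarrow> w \<in> words X"
  by (induction w) (auto simp: inv_word_def)

lemma free_eq_inv_word_left: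
  "w \<in> words X \<Longrightarrow> free_eq X (inv_word w @ w) []"
proof (induction w)
  case Nil
  then show ?case by (simp add: inv_word_def free_eq.refl)
next
  case (Cons a w)
  obtain x b where a: "a = (x, b)" by fastforce
  have w: "w \<in> words X" "x \<in> X" using Cons.prems a by auto
  have "free_eq X (inv_word w @ [(x, \<not> b), (x, \<not> \<not> b)] @ w) (inv_word w @ w)"
    by (rule free_eq.cancel) (use w in auto)
  then have "free_eq X (inv_word w @ [(x, \<not> b), (x, \<not> \<not> b)] @ w) []"
    by (rule free_eq.trans[OF _ Cons.IH[OF w(1)]])
  moreover have "inv_word (a # w) @ a # w = inv_word w @ [(x, \<not> b), (x, \<not> \<not> b)] @ w"
    by (simp add: a inv_word_def)
  ultimately show ?case by (simp only:)
qed

lemma group_free_group: "group (free_group X)"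
proof (rule groupI)
  fix a assume "a \<in> carrier (free_group X)"
  then obtain w where w: "w \<in> words X" "a = free_class X w"
    by (auto simp: carrier_free_group)
  have "free_class X (inv_word w) \<otimes>\<^bsub>free_group X\<^esub> a = \<one>\<^bsub>free_group X\<^esub>"
    using w free_eq_inv_word_left[of w X]
    by (simp add: mult_free_group one_free_group free_class_eq_iff)
  then show "\<exists>b\<in>carrier (free_group X). b \<otimes>\<^bsub>free_group X\<^esub> a = \<one>\<^bsub>free_group X\<^esub>"
    using w by (auto simp: carrier_free_group)
next
  fix a b assume "a \<in> carrier (free_group X)" "b \<in> carrier (free_group X)"
  then obtain u v where "u \<in> words X" "a = free_class X u" "v \<in> words X" "b = free_class X v"
    by (auto simp: carrier_free_group)
  then show "a \<otimes>\<^bsub>free_group X\<^esub> b \<in> carrier (free_group X)"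
    by (simp add: carrier_free_group mult_free_group)
next
  fix a b c
  assume "a \<in> carrier (free_group X)" "b \<in> carrier (free_group X)" "c \<in> carrier (free_group X)"
  then obtain u v w where "u \<in> words X" "a = free_class X u" "v \<in> words X" "b = free_class X v"
    "w \<in> words X" "c = free_class X w"
    by (auto simp: carrier_free_group)
  then show "a \<otimes>\<^bsub>free_group X\<^esub> b \<otimes>\<^bsub>free_group X\<^esub> c
      = a \<otimes>\<^bsub>free_group X\<^esub> (b \<otimes>\<^bsub>free_group X\<^esub> c)"
    by (simp add: mult_free_group)
next
  show "\<one>\<^bsub>free_group X\<^esub> \<in> carrier (free_group X)"
    by (simp add: carrier_free_group one_free_group)
next
  fix a assume "a \<in> carrier (free_group X)"
  then obtain w where "w \<in> words X" "a = free_class X w"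
    by (auto simp: carrier_free_group)
  then show "\<one>\<^bsub>free_group X\<^esub> \<otimes>\<^bsub>free_group X\<^esub> a = a"
    by (simp add: one_free_group mult_free_group)
qed

lemma (in group) normal_closure_normal:
  assumes "S \<subseteq> carrier G"
  shows "normal_closure G S \<lhd> G"
  unfolding normal_closure_def
proof (rule normal_generateI)
  fix h g assume "h \<in> {g \<otimes> s \<otimes> inv g | g s. g \<in> carrier G \<and> s \<in> S}" and g: "g \<in> carrier G"
  then obtain k s where k: "k \<in> carrier G" "s \<in> S" "h = k \<otimes> s \<otimes> inv k" by blast
  then have "g \<otimes> h \<otimes> inv g = (g \<otimes> k) \<otimes> s \<otimes> inv (g \<otimes> k)"
    using g assms by (auto simp: m_assoc inv_mult_group subset_iff)
  moreover have "g \<otimes> k \<in> carrier G" using g k(1) by (rule m_closed)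
  ultimately show "g \<otimes> h \<otimes> inv g \<in> {g \<otimes> s \<otimes> inv g | g s. g \<in> carrier G \<and> s \<in> S}"
    using k(2) by (intro CollectI exI[of _ "g \<otimes> k"] exI[of _ s] conjI)
next
  show "{g \<otimes> s \<otimes> inv g | g s. g \<in> carrier G \<and> s \<in> S} \<subseteq> carrier G"
    using assms by blast
qed

lemma group_presented_group:
  assumes "set (snd P) \<subseteq> words (fst P)"
  shows "group (presented_group P)"
proof -
  have "relator_closure P \<lhd> free_group (fst P)"
    unfolding relator_closure_def
    by (rule group.normal_closure_normal[OF group_free_group])
       (use assms in \<open>auto simp: carrier_free_group\<close>)
  then show ?thesis
    by (simp add: presented_group_def normal.factorgroup_is_group)
qed

lemma induced_aut_apply:
  assumes "double_covering Gh G \<pi>" "characteristic_subgroup (kernel Gh G \<pi>) Gh"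
    and "\<psi> \<in> carrier (AutoGroup Gh)" "x \<in> carrier Gh"
  shows "induced_aut Gh G \<pi> \<psi> (\<pi> x) = \<pi> (\<psi> x)"
proof -
  have "group Gh" "group G" and \<pi>_hom: "\<pi> \<in> hom Gh G"
    using assms(1) unfolding double_covering_def epi_def by blast+
  then interpret \<pi>: group_hom Gh G \<pi>
    by (simp add: group_hom_def group_hom_axioms_def)
  have \<psi>_hom: "\<psi> \<in> hom Gh Gh"
    using assms(3) by (simp add: AutoGroup_def auto_def)
  interpret \<psi>: group_hom Gh Gh \<psi>
    using \<open>group Gh\<close> \<psi>_hom by (simp add: group_hom_def group_hom_axioms_def)
  define y where "y = inv_into (carrier Gh) \<pi> (\<pi> x)"
  have y: "y \<in> carrier Gh" "\<pi> y = \<pi> x"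
    unfolding y_def using assms(4) by (simp_all add: inv_into_into f_inv_into_f)
  have "y \<otimes>\<^bsub>Gh\<^esub> inv\<^bsub>Gh\<^esub> x \<in> kernel Gh G \<pi>"
    using y assms(4) by (simp add: kernel_def)
  then have "\<psi> (y \<otimes>\<^bsub>Gh\<^esub> inv\<^bsub>Gh\<^esub> x) \<in> kernel Gh G \<pi>"
    using assms(2,3) unfolding characteristic_subgroup_def by blast
  then have "\<pi> (\<psi> y) \<otimes>\<^bsub>G\<^esub> inv\<^bsub>G\<^esub> \<pi> (\<psi> x) = \<one>\<^bsub>G\<^esub>"
    using y assms(4) by (simp add: kernel_def)
  then have "\<pi> (\<psi> y) = \<pi> (\<psi> x)"
    using y assms(4) \<pi>.H.inv_solve_right'[of "\<one>\<^bsub>G\<^esub>" "\<pi> (\<psi> y)" "\<pi> (\<psi> x)"] by simp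
  then show ?thesis
    using assms(4) by (simp add: induced_aut_def y_def)
qed

end

theory Submission
  imports Defs
begin

text \<open>Write \<open>z\<close> for the non-trivial kernel element; it is central and \<open>z\<^sup>2 = 1\<close>.

  The proof turns on one fact: \<open>P\<^sub>L\<close> presents \<open>Gh\<close> on generators \<open>f\<^sub>1, \<dots>, f\<^sub>n, z\<close> exactly when
  \<open>P\<close> presents \<open>G\<close> on the images \<open>\<pi> f\<^sub>1, \<dots>, \<pi> f\<^sub>n\<close> and the relators take the values
  \<open>r\<^sub>k(f) = z\<^bsup>L k\<^esup>\<close> prescribed by \<open>L\<close>
  (\<open>presents_base_of_cover\<close> and \<open>presents_cover\<close>). So the tuples \<open>L\<close> for which \<open>P\<^sub>L\<close> presents \<open>Gh\<close>
  record the relator values of the lifts of those generating tuples of \<open>G\<close> on which \<open>P\<close> is a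
  presentation. Any two such tuples of \<open>G\<close> differ by a unique automorphism of \<open>G\<close>; two lifts of one
  tuple differ by powers of \<open>z\<close>, and this changes \<open>L\<close> by a member of \<open>R(C\<^sub>2\<^sup>n)\<close>
  (\<open>eval_word_twist\<close>). Hence the class of \<open>L\<close> depends on the tuple in \<open>G\<close> alone.

  Let \<open>f\<close> realise \<open>P\<^sub>J\<close> and let \<open>\<theta>\<close> be an automorphism of \<open>G\<close>. If \<open>\<theta>\<close> is induced by \<open>\<psi>\<close>, then \<open>\<psi> f\<close> lifts
  \<open>\<theta> (\<pi> f)\<close> and has the same relator values as \<open>f\<close>, because \<open>\<psi>\<close> fixes \<open>z\<close>: passing from \<open>\<pi> f\<close> to
  \<open>\<theta> (\<pi> f)\<close> does not change the class. For a strong covering this holds for every \<open>\<theta>\<close>, so there is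
  only one class (\<open>strong_imp_cover_equiv\<close>). Conversely, if there is only one class, a lift of
  \<open>\<theta> (\<pi> f)\<close> can be corrected by powers of \<open>z\<close> to have relator values \<open>J\<close>; then \<open>P\<^sub>J\<close> presents \<open>Gh\<close> on
  the corrected lift as well as on \<open>f\<close>, and the automorphism that carries \<open>f\<close> to it induces \<open>\<theta>\<close>
  (\<open>unique_class_imp_strong\<close>).\<close>

section \<open>Evaluating words\<close>

lemma eval_word_Nil [simp]: "eval_word H f [] = \<one>\<^bsub>H\<^esub>"
  by (simp add: eval_word_def)

lemma eval_word_Cons [simp]:
  "eval_word H f ((x, b) # w) = (if b then f x else inv\<^bsub>H\<^esub> (f x)) \<otimes>\<^bsub>H\<^esub> eval_word H f w"
  by (simp add: eval_word_def)

lemma eval_word_cong: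
  "w \<in> words X \<Longrightarrow> (\<And>x. x \<in> X \<Longrightarrow> f x = g x) \<Longrightarrow> eval_word H f w = eval_word H g w"
  by (induction w) auto

context group
begin

lemma eval_word_closed [simp]:
  "f \<in> X \<rightarrow> carrier G \<Longrightarrow> w \<in> words X \<Longrightarrow> eval_word G f w \<in> carrier G"
  by (induction w) (auto simp: Pi_def)

lemma eval_word_append:
  "f \<in> X \<rightarrow> carrier G \<Longrightarrow> u \<in> words X \<Longrightarrow> v \<in> words X \<Longrightarrow>
    eval_word G f (u @ v) = eval_word G f u \<otimes> eval_word G f v"
proof (induction u)
  case (Cons a u)
  obtain x b where a: "a = (x, b)" by fastforce
  have "x \<in> X" "u \<in> words X" using Cons.prems a by auto
  then have "f x \<in> carrier G" "eval_word G f u \<in> carrier G" "eval_word G f v \<in> carrier G"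
    using Cons.prems by (auto intro: eval_word_closed[of f X])
  then show ?case
    using Cons.IH Cons.prems \<open>u \<in> words X\<close> by (simp add: a m_assoc)
qed (simp add: eval_word_closed[of f X])

lemma eval_word_free_eq:
  assumes "free_eq X u v" "f \<in> X \<rightarrow> carrier G"
  shows "eval_word G f u = eval_word G f v"
  using assms
proof (induction rule: free_eq.induct)
  case (cancel u v x b)
  have "f x \<in> carrier G" "eval_word G f v \<in> carrier G"
    using cancel by (auto intro: eval_word_closed[of f X])
  then have "eval_word G f ([(x, b), (x, \<not> b)] @ v) = eval_word G f v"
    by (cases b) (simp_all add: m_assoc[symmetric])
  then show ?case
    using cancel eval_word_append[of f X u v]
      eval_word_append[of f X u "[(x, b), (x, \<not> b)] @ v"] by simp
qed simp_all

lemma eval_word_inv_word: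
  assumes "f \<in> X \<rightarrow> carrier G" "w \<in> words X"
  shows "eval_word G f (inv_word w) = inv (eval_word G f w)"
proof -
  have "eval_word G f (inv_word w @ w) = eval_word G f []"
    by (rule eval_word_free_eq[OF free_eq_inv_word_left]) (use assms in auto)
  then have "eval_word G f (inv_word w) \<otimes> eval_word G f w = \<one>"
    using assms by (simp add: eval_word_append[of f X])
  then show ?thesis
    using assms by (metis eval_word_closed inv_equality inv_word_words)
qed

lemma eval_word_centralizes:
  assumes "f \<in> X \<rightarrow> carrier G" "w \<in> words X" "c \<in> carrier G"
    and "\<And>x. x \<in> X \<Longrightarrow> c \<otimes> f x = f x \<otimes> c"
  shows "c \<otimes> eval_word G f w = eval_word G f w \<otimes> c"
  using assms(2)
proof (induction w)
  case Nil
  then show ?case using assms(3) by simp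
next
  case (Cons a w)
  obtain x b where a: "a = (x, b)" by fastforce
  have x: "x \<in> X" and w: "w \<in> words X" using Cons.prems a by auto
  define y where "y = (if b then f x else inv (f x))"
  have fx: "f x \<in> carrier G" and y: "y \<in> carrier G" and e: "eval_word G f w \<in> carrier G"
    using x w assms(1) by (auto simp: y_def intro: eval_word_closed[of f X])
  have "c \<otimes> inv (f x) = inv (f x) \<otimes> c"
    using assms(3) fx assms(4)[OF x]
    by (metis inv_closed inv_solve_left inv_solve_right m_assoc m_closed)
  then have "c \<otimes> y = y \<otimes> c"
    using assms(4)[OF x] by (simp add: y_def)
  then have "c \<otimes> (y \<otimes> eval_word G f w) = (y \<otimes> c) \<otimes> eval_word G f w"
    using assms(3) y e by (simp add: m_assoc[symmetric])
  also have "\<dots> = y \<otimes> eval_word G f w \<otimes> c"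
    using assms(3) y e Cons.IH[OF w] by (simp add: m_assoc)
  finally show ?case
    by (simp add: a y_def)
qed

text \<open>Central factors can be collected at the end of the product. With powers of \<open>z\<close> as factors,
  this compares the relator values of two choices of lifts.\<close>

lemma eval_word_central_mult:
  assumes "f \<in> X \<rightarrow> carrier G" "g \<in> X \<rightarrow> carrier G" "w \<in> words X"
    and central: "\<And>x h. x \<in> X \<Longrightarrow> h \<in> carrier G \<Longrightarrow> g x \<otimes> h = h \<otimes> g x"
  shows "eval_word G (\<lambda>x. f x \<otimes> g x) w = eval_word G f w \<otimes> eval_word G g w"
  using assms(3)
proof (induction w)
  case (Cons a w)
  obtain x b where a: "a = (x, b)" by fastforce
  have x: "x \<in> X" and w: "w \<in> words X" using Cons.prems a by auto
  define F where "F = eval_word G f w"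
  define D where "D = eval_word G g w"
  have fx: "f x \<in> carrier G" and gx: "g x \<in> carrier G" and F: "F \<in> carrier G" and D: "D \<in> carrier G"
    using x w assms(1,2) by (auto simp: F_def D_def intro: eval_word_closed)
  have ig: "inv (g x) \<otimes> h = h \<otimes> inv (g x)" if "h \<in> carrier G" for h
    using that gx central[OF x that]
    by (metis inv_closed inv_solve_left inv_solve_right m_assoc m_closed)
  have swap: "(p \<otimes> q) \<otimes> (F \<otimes> D) = (p \<otimes> F) \<otimes> (q \<otimes> D)"
    if "p \<in> carrier G" "q \<in> carrier G" "q \<otimes> F = F \<otimes> q" for p q
  proof -
    have "(p \<otimes> q) \<otimes> (F \<otimes> D) = p \<otimes> (q \<otimes> F) \<otimes> D"
      using that(1,2) F D by (simp add: m_assoc)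
    also have "\<dots> = (p \<otimes> F) \<otimes> (q \<otimes> D)"
      unfolding that(3) using that(1,2) F D by (simp add: m_assoc)
    finally show ?thesis .
  qed
  have "inv (f x \<otimes> g x) = inv (f x) \<otimes> inv (g x)"
    using fx gx ig[of "inv (f x)"] by (simp add: inv_mult_group)
  then show ?case
    using Cons.IH[OF w] fx gx F ig central[OF x]
      swap[of "f x" "g x"] swap[of "inv (f x)" "inv (g x)"]
    by (simp add: a F_def[symmetric] D_def[symmetric])
qed simp

lemma eval_word_filter_trivial:
  assumes "f \<in> X \<rightarrow> carrier G" "w \<in> words X" "f y = \<one>"
  shows "eval_word G f (filter (\<lambda>(x, b). x \<noteq> y) w) = eval_word G f w"
  using assms(2)
proof (induction w)
  case (Cons a w)
  then show ?case
    using assms(3) by (cases a) (auto simp: eval_word_closed[OF assms(1)])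
qed simp

end

lemma filter_words: "w \<in> words X \<Longrightarrow> filter (\<lambda>(x, b). x \<noteq> y) w \<in> words (X - {y})"
  by (induction w) auto

lemma words_mono: "w \<in> words X \<Longrightarrow> X \<subseteq> Y \<Longrightarrow> w \<in> words Y"
  by (auto simp: words_def)

lemma (in group_hom) eval_word_hom:
  assumes "f \<in> X \<rightarrow> carrier G" "w \<in> words X"
  shows "eval_word H (\<lambda>x. h (f x)) w = h (eval_word G f w)"
  using assms(2)
proof (induction w)
  case (Cons a w)
  then show ?case
    using assms(1) by (cases a) (auto simp: Pi_def)
qed simp

section \<open>Presentations in terms of words\<close>

definition consequence :: "'x presentation \<Rightarrow> 'x word \<Rightarrow> bool" where
  "consequence P w \<longleftrightarrow> free_class (fst P) w \<in> relator_closure P"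

text \<open>This is stated for words, so that a presentation can be proved and used by computing values of
  words; \<open>presents_iff_iso\<close> is the link to isomorphisms.\<close>

definition presents ::
    "'x presentation \<Rightarrow> ('a, 'c) monoid_scheme \<Rightarrow> ('x \<Rightarrow> 'a) \<Rightarrow> bool" where
  "presents P H f \<longleftrightarrow>
     f \<in> fst P \<rightarrow> carrier H \<and>
     (\<forall>h \<in> carrier H. \<exists>w \<in> words (fst P). eval_word H f w = h) \<and>
     (\<forall>w \<in> words (fst P). eval_word H f w = \<one>\<^bsub>H\<^esub> \<longleftrightarrow> consequence P w)"

text \<open>The image is a singleton when \<open>A\<close> is a class and \<open>H\<close> a group, by \<open>free_lift_class\<close>.\<close>

definition free_lift ::
    "('a, 'c) monoid_scheme \<Rightarrow> ('x \<Rightarrow> 'a) \<Rightarrow> 'x word set \<Rightarrow> 'a" where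
  "free_lift H f A = the_elem (eval_word H f ` A)"

lemma (in group) free_lift_class:
  assumes "f \<in> X \<rightarrow> carrier G" "w \<in> words X"
  shows "free_lift G f (free_class X w) = eval_word G f w"
proof -
  have "w \<in> free_class X w"
    using assms by (simp add: free_class_def free_rel_def free_eq.refl)
  moreover have "eval_word G f v = eval_word G f w" if "v \<in> free_class X w" for v
    using that assms(1) eval_word_free_eq[of X w v f] by (simp add: free_class_def free_rel_def)
  ultimately show ?thesis
    unfolding free_lift_def by (metis the_elem_image_unique empty_iff)
qed

lemma (in group) free_lift_hom:
  assumes "f \<in> X \<rightarrow> carrier G"
  shows "group_hom (free_group X) G (free_lift G f)"
  by (intro group_hom.intro group_hom_axioms.intro group_free_group group_axioms homI)
     (auto simp: carrier_free_group mult_free_group free_lift_class[OF assms]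
        eval_word_append[OF assms] eval_word_closed[OF assms])

lemma free_class_relators:
  "set (snd P) \<subseteq> words (fst P) \<Longrightarrow>
    free_class (fst P) ` set (snd P) \<subseteq> carrier (free_group (fst P))"
  by (auto simp: carrier_free_group)

lemma relator_closure_normal:
  "set (snd P) \<subseteq> words (fst P) \<Longrightarrow> relator_closure P \<lhd> free_group (fst P)"
  unfolding relator_closure_def
  by (rule group.normal_closure_normal[OF group_free_group free_class_relators])

lemma relator_consequence:
  assumes "set (snd P) \<subseteq> words (fst P)" "r \<in> set (snd P)"
  shows "consequence P r"
proof -
  interpret F: group "free_group (fst P)" by (rule group_free_group)
  have c: "free_class (fst P) r \<in> carrier (free_group (fst P))"
    using assms by (auto simp: carrier_free_group)
  have "free_class (fst P) r = \<one>\<^bsub>free_group (fst P)\<^esub> \<otimes>\<^bsub>free_group (fst P)\<^esub> free_class (fst P) r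
      \<otimes>\<^bsub>free_group (fst P)\<^esub> inv\<^bsub>free_group (fst P)\<^esub> \<one>\<^bsub>free_group (fst P)\<^esub>"
    using c by simp
  then show ?thesis
    unfolding consequence_def relator_closure_def normal_closure_def
    using assms(2) by (intro generate.incl CollectI) blast
qed

text \<open>Von Dyck's theorem: the normal closure of the relators lies in the kernel of the evaluation,
  because a kernel is normal.\<close>

lemma (in group) eval_word_consequence:
  assumes "f \<in> fst P \<rightarrow> carrier G" "set (snd P) \<subseteq> words (fst P)"
    and "\<And>r. r \<in> set (snd P) \<Longrightarrow> eval_word G f r = \<one>"
    and "consequence P w" "w \<in> words (fst P)"
  shows "eval_word G f w = \<one>"
proof -
  interpret lift: group_hom "free_group (fst P)" G "free_lift G f"
    by (rule free_lift_hom[OF assms(1)])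
  let ?K = "kernel (free_group (fst P)) G (free_lift G f)"
  have "free_class (fst P) r \<in> ?K" if "r \<in> set (snd P)" for r
    using that assms by (auto simp: kernel_def carrier_free_group free_lift_class[OF assms(1)])
  then have "relator_closure P \<subseteq> ?K"
    unfolding relator_closure_def normal_closure_def
    by (intro lift.G.generate_subgroup_incl lift.subgroup_kernel)
       (auto intro: normal.inv_op_closed2[OF lift.normal_kernel])
  then show ?thesis
    using assms(1,4,5) by (auto simp: consequence_def kernel_def free_lift_class)
qed

text \<open>From words to isomorphisms this is the first isomorphism theorem for the evaluation on the
  free group, whose image is \<open>H\<close> and whose kernel is the relator closure. In the other direction,
  the composition of an isomorphism with the quotient map is the evaluation, since both are
  homomorphisms that agree on generators.\<close>

lemma presents_iff_iso:
  assumes "group H" "set (snd P) \<subseteq> words (fst P)"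
  shows "presents P H f \<longleftrightarrow>
    (\<exists>\<phi> \<in> iso (presented_group P) H. \<forall>x \<in> fst P. \<phi> (pres_gen P x) = f x)"
proof -
  interpret H: group H by fact
  let ?X = "fst P" and ?F = "free_group (fst P)" and ?N = "relator_closure P"
  interpret N: normal ?N ?F by (rule relator_closure_normal[OF assms(2)])
  show ?thesis
  proof
    assume p: "presents P H f"
    then have f: "f \<in> ?X \<rightarrow> carrier H" by (simp add: presents_def)
    interpret lift: group_hom ?F H "free_lift H f" by (rule H.free_lift_hom[OF f])
    have ker: "kernel ?F H (free_lift H f) = ?N"
    proof -
      have "A \<in> kernel ?F H (free_lift H f) \<longleftrightarrow> A \<in> ?N" if "A \<in> carrier ?F" for A
        using that p f
        by (auto simp: carrier_free_group kernel_def H.free_lift_class presents_def consequence_def)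
      then show ?thesis
        using N.subset by (auto simp: kernel_def)
    qed
    have surj: "free_lift H f ` carrier ?F = carrier H"
    proof
      show "carrier H \<subseteq> free_lift H f ` carrier ?F"
      proof
        fix h assume "h \<in> carrier H"
        then obtain w where "w \<in> words ?X" "eval_word H f w = h"
          using p by (auto simp: presents_def)
        then show "h \<in> free_lift H f ` carrier ?F"
          using H.free_lift_class[OF f] by (force simp: carrier_free_group)
      qed
    qed auto
    have iso: "(\<lambda>A. the_elem (free_lift H f ` A)) \<in> iso (presented_group P) H"
      using lift.FactGroup_iso_set[OF surj] by (simp add: ker presented_group_def)
    have "the_elem (free_lift H f ` pres_gen P x) = f x" if x: "x \<in> ?X" for x
    proof -
      have c: "free_class ?X [(x, True)] \<in> carrier ?F" 
        using x by (auto simp: carrier_free_group)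
      have val: "free_lift H f (free_class ?X [(x, True)]) = f x"
        using x f by (auto simp: H.free_lift_class[OF f] Pi_def)
      have mem: "free_class ?X [(x, True)] \<in> pres_gen P x"
        unfolding pres_gen_def by (rule N.rcos_self[OF c N.subgroup_axioms])
      have "free_lift H f A = f x" if A: "A \<in> pres_gen P x" for A
      proof -
        obtain k where k: "k \<in> ?N" "A = k \<otimes>\<^bsub>?F\<^esub> free_class ?X [(x, True)]"
          using A by (auto simp: pres_gen_def r_coset_def)
        have "k \<in> kernel ?F H (free_lift H f)" using k(1) by (simp only: ker)
        then have "k \<in> carrier ?F" "free_lift H f k = \<one>\<^bsub>H\<^esub>"
          by (simp_all add: kernel_def)
        moreover have "f x \<in> carrier H" using f x by blast
        ultimately show ?thesis
          using c val by (simp add: k(2))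
      qed
      then have "free_lift H f ` pres_gen P x = {f x}"
        using mem by (auto intro!: rev_image_eqI[OF mem])
      then show ?thesis by simp
    qed
    then show "\<exists>\<phi> \<in> iso (presented_group P) H. \<forall>x \<in> fst P. \<phi> (pres_gen P x) = f x"
      by (intro bexI[OF _ iso]) simp
  next
    assume "\<exists>\<phi> \<in> iso (presented_group P) H. \<forall>x \<in> fst P. \<phi> (pres_gen P x) = f x"
    then obtain \<phi> where \<phi>: "\<phi> \<in> iso (presented_group P) H"
      and gen: "\<And>x. x \<in> ?X \<Longrightarrow> \<phi> (pres_gen P x) = f x" by blast
    interpret Q: group "presented_group P" by (rule group_presented_group[OF assms(2)])
    interpret \<phi>: group_hom "presented_group P" H \<phi>
      using \<phi> by unfold_locales (simp add: iso_def)
    have quot: "(\<lambda>A. ?N #>\<^bsub>?F\<^esub> A) \<in> hom ?F (presented_group P)"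
      unfolding presented_group_def by (rule N.r_coset_hom_Mod)
    define \<psi> where "\<psi> = (\<lambda>A. \<phi> (?N #>\<^bsub>?F\<^esub> A))"
    interpret \<psi>: group_hom ?F H \<psi>
      using hom_compose[OF quot \<phi>.homh] by unfold_locales (simp add: \<psi>_def comp_def)
    have gens: "(\<lambda>x. free_class ?X [(x, True)]) \<in> ?X \<rightarrow> carrier ?F"
      by (auto simp: carrier_free_group)
    have word: "eval_word ?F (\<lambda>x. free_class ?X [(x, True)]) w = free_class ?X w"
      if "w \<in> words ?X" for w
      using that
    proof (induction w)
      case (Cons a w)
      obtain x b where a: "a = (x, b)" by fastforce
      have x: "x \<in> ?X" and w: "w \<in> words ?X" using Cons.prems a by auto
      have "inv\<^bsub>?F\<^esub> (free_class ?X [(x, True)]) = free_class ?X [(x, False)]"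
      proof (rule N.inv_equality)
        show "free_class ?X [(x, False)] \<otimes>\<^bsub>?F\<^esub> free_class ?X [(x, True)] = \<one>\<^bsub>?F\<^esub>"
          using x free_eq.cancel[of "[]" ?X "[]" x False]
          by (simp add: mult_free_group one_free_group free_class_eq_iff)
      qed (use x in \<open>auto simp: carrier_free_group\<close>)
      then show ?case
        using Cons.IH[OF w] x w by (auto simp: a mult_free_group)
    qed (simp add: one_free_group)
    have f: "f \<in> ?X \<rightarrow> carrier H"
    proof
      fix x assume x: "x \<in> ?X"
      then have "\<psi> (free_class ?X [(x, True)]) = f x"
        using gen by (simp add: \<psi>_def pres_gen_def)
      then show "f x \<in> carrier H"
        using gens x \<psi>.hom_closed by (metis PiE)
    qed
    have eval: "eval_word H f w = \<psi> (free_class ?X w)" if w: "w \<in> words ?X" for w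
    proof -
      have "eval_word H f w = eval_word H (\<lambda>x. \<psi> (free_class ?X [(x, True)])) w"
        by (rule eval_word_cong[OF w]) (use gen in \<open>simp add: \<psi>_def pres_gen_def\<close>)
      then show ?thesis
        using \<psi>.eval_word_hom[OF gens w] word[OF w] by simp
    qed
    have "\<exists>w \<in> words ?X. eval_word H f w = h" if "h \<in> carrier H" for h
    proof -
      have "h \<in> \<phi> ` carrier (presented_group P)"
        using \<phi> that by (auto simp: iso_def bij_betw_def)
      then obtain w where "w \<in> words ?X" "h = \<phi> (?N #>\<^bsub>?F\<^esub> free_class ?X w)"
        by (auto simp: presented_group_def FactGroup_def RCOSETS_def carrier_free_group)
      then show ?thesis
        using eval by (auto simp: \<psi>_def)
    qed
    moreover have "eval_word H f w = \<one>\<^bsub>H\<^esub> \<longleftrightarrow> consequence P w" if w: "w \<in> words ?X" for w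
    proof -
      have c: "free_class ?X w \<in> carrier ?F" using w by (simp add: carrier_free_group)
      then have "?N #>\<^bsub>?F\<^esub> free_class ?X w \<in> carrier (presented_group P)"
        using quot by (auto simp: hom_def)
      then have "\<psi> (free_class ?X w) = \<one>\<^bsub>H\<^esub> \<longleftrightarrow> ?N #>\<^bsub>?F\<^esub> free_class ?X w = \<one>\<^bsub>presented_group P\<^esub>"
        using \<phi> \<phi>.hom_one \<phi>.iso_iff by (auto simp: \<psi>_def)
      also have "\<dots> \<longleftrightarrow> ?N #>\<^bsub>?F\<^esub> free_class ?X w = ?N"
        by (simp add: presented_group_def FactGroup_def)
      also have "\<dots> \<longleftrightarrow> free_class ?X w \<in> ?N"
        using N.coset_join1[OF _ c N.subgroup_axioms] N.coset_join2[OF c N.subgroup_axioms]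
        by blast
      finally show ?thesis
        by (simp add: eval[OF w] consequence_def)
    qed
    ultimately show "presents P H f"
      using f by (simp add: presents_def)
  qed
qed

lemma presents_presented_group:
  assumes "set (snd P) \<subseteq> words (fst P)"
  shows "presents P (presented_group P) (pres_gen P)"
proof -
  have id: "(\<lambda>q. q) \<in> iso (presented_group P) (presented_group P)"
    by (simp add: iso_def hom_def bij_betw_def)
  show ?thesis
    by (rule iffD2[OF presents_iff_iso[OF group_presented_group[OF assms] assms]],
        rule bexI[OF _ id]) simp
qed

lemma presents_relator:
  "presents P H f \<Longrightarrow> set (snd P) \<subseteq> words (fst P) \<Longrightarrow> r \<in> set (snd P) \<Longrightarrow>
    eval_word H f r = \<one>\<^bsub>H\<^esub>"
  using relator_consequence[of P r] by (auto simp: presents_def)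

lemma presents_transport_iso:
  assumes "presents P H f" "\<theta> \<in> iso H K" "group H" "group K"
  shows "presents P K (\<lambda>x. \<theta> (f x))"
proof -
  interpret \<theta>: group_hom H K \<theta>
    using assms by (simp add: group_hom_def group_hom_axioms_def iso_def)
  have f: "f \<in> fst P \<rightarrow> carrier H" using assms(1) by (simp add: presents_def)
  have "\<exists>w \<in> words (fst P). \<theta> (eval_word H f w) = k" if "k \<in> carrier K" for k
  proof -
    have "k \<in> \<theta> ` carrier H"
      using that assms(2) by (simp add: iso_def bij_betw_def)
    then obtain h where "h \<in> carrier H" "k = \<theta> h"
      by blast
    then show ?thesis using assms(1) by (fastforce simp: presents_def)
  qed
  moreover have "\<theta> (eval_word H f w) = \<one>\<^bsub>K\<^esub> \<longleftrightarrow> eval_word H f w = \<one>\<^bsub>H\<^esub>" if "w \<in> words (fst P)" for w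
    using \<theta>.iso_iff assms(2) \<theta>.G.eval_word_closed[OF f that] by auto
  moreover have "(\<lambda>x. \<theta> (f x)) \<in> fst P \<rightarrow> carrier K"
    using f by (simp add: Pi_iff)
  ultimately show ?thesis
    using assms(1) by (simp add: presents_def \<theta>.eval_word_hom[OF f])
qed

lemma AutoGroup_iff:
  "\<psi> \<in> carrier (AutoGroup H) \<longleftrightarrow> \<psi> \<in> iso H H \<and> \<psi> \<in> extensional (carrier H)"
  by (auto simp: AutoGroup_def auto_def Bij_def iso_def)

lemma restrict_iso:
  "group H \<Longrightarrow> \<theta> \<in> iso H K \<Longrightarrow> restrict \<theta> (carrier H) \<in> iso H K"
  using bij_betw_restrict_eq[of \<theta> "carrier H" "carrier K"]
  by (simp add: iso_def hom_def group.is_monoid monoid.m_closed Pi_iff)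

lemma presents_aut:
  assumes "group H" "set (snd P) \<subseteq> words (fst P)" "presents P H f" "presents P H g"
  obtains \<psi> where "\<psi> \<in> carrier (AutoGroup H)" "\<And>x. x \<in> fst P \<Longrightarrow> \<psi> (f x) = g x"
proof -
  obtain \<phi> where \<phi>: "\<phi> \<in> iso (presented_group P) H" "\<And>x. x \<in> fst P \<Longrightarrow> \<phi> (pres_gen P x) = f x"
    using presents_iff_iso[OF assms(1,2), of f] assms(3) by auto
  obtain \<gamma> where \<gamma>: "\<gamma> \<in> iso (presented_group P) H" "\<And>x. x \<in> fst P \<Longrightarrow> \<gamma> (pres_gen P x) = g x"
    using presents_iff_iso[OF assms(1,2), of g] assms(4) by auto
  interpret Q: group "presented_group P" by (rule group_presented_group[OF assms(2)])
  let ?\<theta> = "\<gamma> \<circ> inv_into (carrier (presented_group P)) \<phi>"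
  have "?\<theta> \<in> iso H H"
    by (rule iso_set_trans[OF Q.iso_set_sym[OF \<phi>(1)] \<gamma>(1)])
  then have "restrict ?\<theta> (carrier H) \<in> carrier (AutoGroup H)"
    using restrict_iso[OF assms(1)] by (simp add: AutoGroup_iff)
  moreover have "restrict ?\<theta> (carrier H) (f x) = g x" if x: "x \<in> fst P" for x
  proof -
    have q: "pres_gen P x \<in> carrier (presented_group P)"
      using presents_presented_group[OF assms(2)] x by (auto simp: presents_def)
    then have "inv_into (carrier (presented_group P)) \<phi> (f x) = pres_gen P x"
      using \<phi>(1) by (simp add: \<phi>(2)[OF x, symmetric] iso_def bij_betw_def)
    moreover have "f x \<in> carrier H" using assms(3) x by (auto simp: presents_def)
    ultimately show ?thesis using \<gamma>(2)[OF x] by simp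
  qed
  ultimately show thesis using that by blast
qed

lemma presents_cong:
  assumes "\<And>x. x \<in> fst P \<Longrightarrow> f x = g x"
  shows "presents P H f \<longleftrightarrow> presents P H g"
  using eval_word_cong[of _ "fst P" f g H] assms by (simp add: presents_def Pi_iff)

lemma presents_hom_eq:
  assumes "presents P H f" "group H" "group K" "\<theta> \<in> hom H K" "\<theta>' \<in> hom H K"
    and agree: "\<And>x. x \<in> fst P \<Longrightarrow> \<theta> (f x) = \<theta>' (f x)" and "h \<in> carrier H"
  shows "\<theta> h = \<theta>' h"
proof -
  interpret \<theta>: group_hom H K \<theta>
    using assms by (simp add: group_hom_def group_hom_axioms_def)
  interpret \<theta>': group_hom H K \<theta>'
    using assms by (simp add: group_hom_def group_hom_axioms_def)
  have f: "f \<in> fst P \<rightarrow> carrier H" using assms(1) by (simp add: presents_def)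
  obtain w where w: "w \<in> words (fst P)" "eval_word H f w = h"
    using assms(1) \<open>h \<in> carrier H\<close> by (auto simp: presents_def)
  have "eval_word K (\<lambda>x. \<theta> (f x)) w = eval_word K (\<lambda>x. \<theta>' (f x)) w"
    by (rule eval_word_cong[OF w(1) agree])
  then show ?thesis
    using \<theta>.eval_word_hom[OF f w(1)] \<theta>'.eval_word_hom[OF f w(1)] w(2) by simp
qed

section \<open>The group of order two and the relator values\<close>

lemma carrier_C2: "carrier C2 = {0, 1}"
  by (auto simp: carrier_integer_mod_group)

text \<open>This is \<open>j \<mapsto> c\<^sup>j\<close>, the homomorphism from \<open>C\<^sub>2\<close> that sends \<open>i\<close> to an element \<open>c\<close> with
  \<open>c\<^sup>2 = 1\<close>.\<close>

definition C2_embed :: "('a, 'c) monoid_scheme \<Rightarrow> 'a \<Rightarrow> int \<Rightarrow> 'a" where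
  "C2_embed H c j = (if j = \<one>\<^bsub>C2\<^esub> then \<one>\<^bsub>H\<^esub> else c)"

lemma relator_values_hom:
  assumes "set R \<subseteq> words {..<n}"
  shows "relator_values R \<in> hom (C2_pow n) (C2_pow (length R))"
proof (rule homI)
  interpret C: group C2 by simp
  have w: "R ! k \<in> words {..<n}" if "k < length R" for k
    using assms that by (auto simp: subset_iff)
  fix I I' assume I: "I \<in> carrier (C2_pow n)" "I' \<in> carrier (C2_pow n)"
  then have f: "I \<in> {..<n} \<rightarrow> carrier C2" "I' \<in> {..<n} \<rightarrow> carrier C2"
    by auto
  show "relator_values R I \<in> carrier (C2_pow (length R))"
    using C.eval_word_closed[OF f(1) w] by (simp add: relator_values_def)
  have "eval_word C2 (I \<otimes>\<^bsub>C2_pow n\<^esub> I') (R ! k)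
      = eval_word C2 I (R ! k) \<otimes>\<^bsub>C2\<^esub> eval_word C2 I' (R ! k)" if "k < length R" for k
  proof -
    have "eval_word C2 (I \<otimes>\<^bsub>C2_pow n\<^esub> I') (R ! k)
        = eval_word C2 (\<lambda>l. I l \<otimes>\<^bsub>C2\<^esub> I' l) (R ! k)"
      by (rule eval_word_cong[OF w[OF that]]) simp
    also have "\<dots> = eval_word C2 I (R ! k) \<otimes>\<^bsub>C2\<^esub> eval_word C2 I' (R ! k)"
      by (rule C.eval_word_central_mult[OF f w[OF that]]) (simp add: add.commute)
    finally show ?thesis .
  qed
  then show "relator_values R (I \<otimes>\<^bsub>C2_pow n\<^esub> I')
      = relator_values R I \<otimes>\<^bsub>C2_pow (length R)\<^esub> relator_values R I'"
    by (auto simp: relator_values_def)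
qed

lemma relator_values_subgroup:
  assumes "set R \<subseteq> words {..<n}"
  shows "subgroup (relator_values R ` carrier (C2_pow n)) (C2_pow (length R))"
proof -
  interpret group_hom "C2_pow n" "C2_pow (length R)" "relator_values R"
    using relator_values_hom[OF assms] by (intro group_hom.intro group_hom_axioms.intro) simp_all
  show ?thesis by (rule img_is_subgroup)
qed

lemma cover_equiv_iff:
  assumes "L \<in> carrier (C2_pow (length R))"
  shows "cover_equiv n R J L \<longleftrightarrow>
    (\<exists>I \<in> carrier (C2_pow n). \<forall>k < length R. L k = eval_word C2 I (R ! k) \<otimes>\<^bsub>C2\<^esub> J k)"
proof -
  have "L = relator_values R I \<otimes>\<^bsub>C2_pow (length R)\<^esub> J \<longleftrightarrow>
      (\<forall>k < length R. L k = eval_word C2 I (R ! k) \<otimes>\<^bsub>C2\<^esub> J k)" for I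
  proof
    assume "L = relator_values R I \<otimes>\<^bsub>C2_pow (length R)\<^esub> J"
    then show "\<forall>k < length R. L k = eval_word C2 I (R ! k) \<otimes>\<^bsub>C2\<^esub> J k"
      by (simp add: relator_values_def)
  next
    assume h: "\<forall>k < length R. L k = eval_word C2 I (R ! k) \<otimes>\<^bsub>C2\<^esub> J k"
    show "L = relator_values R I \<otimes>\<^bsub>C2_pow (length R)\<^esub> J"
    proof
      fix k show "L k = (relator_values R I \<otimes>\<^bsub>C2_pow (length R)\<^esub> J) k"
        using assms h by (cases "k < length R") (auto simp: relator_values_def PiE_def extensional_def)
    qed
  qed
  then show ?thesis
    by (auto simp: cover_equiv_def r_coset_def)
qed

text \<open>The \<open>k\<close>-th relator of \<open>P\<^sub>L\<close> has the letter \<open>i\<^sup>-\<^sup>1\<close> after \<open>r\<^sub>k\<close> iff the \<open>k\<close>-th entry of \<open>L\<close> is not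
  \<open>1\<close>. Outside the index set both tuples have the default value \<open>undefined\<close>.\<close>

lemma cover_pres_inj:
  assumes "L \<in> carrier (C2_pow (length R))" "L' \<in> carrier (C2_pow (length R))"
    and "cover_pres n R L = cover_pres n R L'"
  shows "L = L'"
proof
  fix k
  show "L k = L' k"
  proof (cases "k < length R")
    case True
    have "L k \<in> carrier C2" "L' k \<in> carrier C2"
      using assms(1,2) True by auto
    then have L: "L k \<in> {0, 1}" "L' k \<in> {0, 1}"
      by (simp_all only: carrier_C2)
    have "R ! k @ inv_word (C2_word n (L k)) = snd (cover_pres n R L) ! k" for L
      using True by (simp add: cover_pres_def nth_append)
    then have "R ! k @ inv_word (C2_word n (L k)) = R ! k @ inv_word (C2_word n (L' k))"
      using assms(3) by simp
    then show ?thesis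
      using L by (auto simp: C2_word_def inv_word_def)
  next
    case False
    then show ?thesis using assms(1,2) by (simp add: PiE_def extensional_def)
  qed
qed

text \<open>Classes are cosets of the subgroup \<open>R(C\<^sub>2\<^sup>n)\<close>, and \<open>L\<close> can be read off the relators of \<open>P\<^sub>L\<close>.\<close>

lemma pres_class_eq_iff:
  assumes "set R \<subseteq> words {..<n}"
    and J: "J \<in> carrier (C2_pow (length R))" and L: "L \<in> carrier (C2_pow (length R))"
  shows "pres_class n R L = pres_class n R J \<longleftrightarrow> cover_equiv n R J L"
proof -
  interpret C: group "C2_pow (length R)" by simp
  note sub = relator_values_subgroup[OF assms(1)]
  have "cover_equiv n R L L"
    using C.rcos_self[OF L sub] by (simp add: cover_equiv_def)
  then have mem: "cover_pres n R L \<in> pres_class n R L"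
    unfolding pres_class_def using L by blast
  have "cover_equiv n R J L" if "pres_class n R L = pres_class n R J"
  proof -
    have "cover_pres n R L \<in> pres_class n R J"
      using mem that by simp
    then obtain L' where "cover_pres n R L = cover_pres n R L'"
      "L' \<in> carrier (C2_pow (length R))" "cover_equiv n R J L'"
      unfolding pres_class_def by blast
    then show ?thesis
      using cover_pres_inj[OF L] by blast
  qed
  moreover have "pres_class n R L = pres_class n R J" if "cover_equiv n R J L"
    using C.repr_independence[OF _ J sub] that by (simp add: cover_equiv_def pres_class_def)
  ultimately show ?thesis by blast
qed

section \<open>Presentations of a double covering\<close>

lemma fst_cover_pres [simp]: "fst (cover_pres n R L) = {..<n} \<union> {n}"
  by (simp add: cover_pres_def)

lemma cover_pres_words:
  assumes "set R \<subseteq> words {..<n}"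
  shows "set (snd (cover_pres n R L)) \<subseteq> words (fst (cover_pres n R L))"
proof -
  have "R ! k \<in> words ({..<n} \<union> {n})" if "k < length R" for k
    by (rule words_mono[of _ "{..<n}"]) (use assms nth_mem[OF that] in blast)+
  then show ?thesis
    by (auto simp: cover_pres_def C2_word_def comm_word_def inv_word_def)
qed

text \<open>Together with \<open>eval_word_consequence\<close> this says which assignments of the generators define a
  homomorphism on the group presented by \<open>P\<^sub>L\<close>.\<close>

lemma cover_relators_trivial_iff:
  assumes "group H" "set R \<subseteq> words {..<n}" "f \<in> {..<n} \<union> {n} \<rightarrow> carrier H"
  shows "(\<forall>r \<in> set (snd (cover_pres n R L)). eval_word H f r = \<one>\<^bsub>H\<^esub>) \<longleftrightarrow>
    (\<forall>k < length R. eval_word H f (R ! k) = C2_embed H (f n) (L k)) \<and>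
    f n \<otimes>\<^bsub>H\<^esub> f n = \<one>\<^bsub>H\<^esub> \<and> (\<forall>l < n. f n \<otimes>\<^bsub>H\<^esub> f l = f l \<otimes>\<^bsub>H\<^esub> f n)"
proof -
  interpret H: group H by fact
  have c: "f n \<in> carrier H" and x: "\<And>l. l < n \<Longrightarrow> f l \<in> carrier H"
    using assms(3) by auto
  have "eval_word H f (R ! k @ inv_word (C2_word n (L k))) = \<one>\<^bsub>H\<^esub> \<longleftrightarrow>
      eval_word H f (R ! k) = C2_embed H (f n) (L k)" if k: "k < length R" for k
  proof -
    have "R ! k \<in> words {..<n}"
      using assms(2) nth_mem[OF k] by blast
    then have r: "R ! k \<in> words ({..<n} \<union> {n})"
      by (rule words_mono) blast
    have v: "C2_word n (L k) \<in> words ({..<n} \<union> {n})"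
      by (simp add: C2_word_def)
    have "eval_word H f (C2_word n (L k)) = C2_embed H (f n) (L k)"
      using c by (simp add: C2_word_def C2_embed_def)
    then have "eval_word H f (R ! k @ inv_word (C2_word n (L k)))
        = eval_word H f (R ! k) \<otimes>\<^bsub>H\<^esub> inv\<^bsub>H\<^esub> (C2_embed H (f n) (L k))"
      using r v by (simp add: H.eval_word_append[OF assms(3)] H.eval_word_inv_word[OF assms(3)])
    moreover have "C2_embed H (f n) (L k) \<in> carrier H"
      using c by (simp add: C2_embed_def)
    ultimately show ?thesis
      using H.eval_word_closed[OF assms(3) r] H.inv_solve_right'[of "\<one>\<^bsub>H\<^esub>"] by simp
  qed
  moreover have "eval_word H f (comm_word n l) = \<one>\<^bsub>H\<^esub> \<longleftrightarrow> f n \<otimes>\<^bsub>H\<^esub> f l = f l \<otimes>\<^bsub>H\<^esub> f n"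
    if l: "l < n" for l
  proof -
    have "eval_word H f (comm_word n l) = inv\<^bsub>H\<^esub> (f l \<otimes>\<^bsub>H\<^esub> f n) \<otimes>\<^bsub>H\<^esub> (f n \<otimes>\<^bsub>H\<^esub> f l)"
      using c x[OF l] by (simp add: comm_word_def H.inv_mult_group H.m_assoc)
    then show ?thesis
      using c x[OF l] H.inv_solve_left'[of "\<one>\<^bsub>H\<^esub>" "f l \<otimes>\<^bsub>H\<^esub> f n" "f n \<otimes>\<^bsub>H\<^esub> f l"] by simp
  qed
  moreover have "eval_word H f [(n, True), (n, True)] = f n \<otimes>\<^bsub>H\<^esub> f n"
    using c by simp
  moreover have "set (snd (cover_pres n R L)) =
      (\<lambda>k. R ! k @ inv_word (C2_word n (L k))) ` {..<length R} \<union> {[(n, True), (n, True)]}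
      \<union> comm_word n ` {..<n}"
    by (auto simp: cover_pres_def)
  ultimately show ?thesis
    by (auto simp del: eval_word_Cons)
qed

locale pointed_double_covering = group_hom Gh G \<pi>
  for Gh :: "('a, 'c) monoid_scheme" and G :: "('b, 'd) monoid_scheme" and \<pi> +
  fixes z
  assumes onto: "\<pi> ` carrier Gh = carrier G"
    and kernel_eq: "kernel Gh G \<pi> = {\<one>\<^bsub>Gh\<^esub>, z}"
    and z_nontrivial: "z \<noteq> \<one>\<^bsub>Gh\<^esub>"
begin

lemma z_closed [simp]: "z \<in> carrier Gh"
  using kernel_eq by (auto simp: kernel_def)

lemma pi_z [simp]: "\<pi> z = \<one>\<^bsub>G\<^esub>"
  using kernel_eq by (auto simp: kernel_def)

lemma obtain_lift:
  assumes "g \<in> carrier G"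
  obtains x where "x \<in> carrier Gh" "g = \<pi> x"
  using assms onto by (metis imageE)

lemma kernel_cases: "h \<in> carrier Gh \<Longrightarrow> \<pi> h = \<one>\<^bsub>G\<^esub> \<Longrightarrow> h = \<one>\<^bsub>Gh\<^esub> \<or> h = z"
  using kernel_eq by (auto simp: kernel_def)

lemma z_square: "z \<otimes>\<^bsub>Gh\<^esub> z = \<one>\<^bsub>Gh\<^esub>"
proof -
  have "z \<otimes>\<^bsub>Gh\<^esub> z \<noteq> z"
    using z_nontrivial by simp
  then show ?thesis
    using kernel_cases[of "z \<otimes>\<^bsub>Gh\<^esub> z"] by simp
qed

lemma z_central:
  assumes "h \<in> carrier Gh"
  shows "z \<otimes>\<^bsub>Gh\<^esub> h = h \<otimes>\<^bsub>Gh\<^esub> z"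
proof -
  have "h \<otimes>\<^bsub>Gh\<^esub> z \<otimes>\<^bsub>Gh\<^esub> inv\<^bsub>Gh\<^esub> h \<noteq> \<one>\<^bsub>Gh\<^esub>"
    using assms z_nontrivial by (simp add: G.inv_solve_right'[of "\<one>\<^bsub>Gh\<^esub>"])
  then have "h \<otimes>\<^bsub>Gh\<^esub> z \<otimes>\<^bsub>Gh\<^esub> inv\<^bsub>Gh\<^esub> h = z"
    using kernel_cases[of "h \<otimes>\<^bsub>Gh\<^esub> z \<otimes>\<^bsub>Gh\<^esub> inv\<^bsub>Gh\<^esub> h"] assms by simp
  then show ?thesis
    using assms by (simp add: G.inv_solve_right'[of z])
qed

abbreviation sign :: "int \<Rightarrow> 'a" where
  "sign \<equiv> C2_embed Gh z"

lemma sign_closed [simp]: "sign j \<in> carrier Gh"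
  by (simp add: C2_embed_def)

lemma pi_sign [simp]: "\<pi> (sign j) = \<one>\<^bsub>G\<^esub>"
  by (simp add: C2_embed_def)

lemma sign_hom: "group_hom C2 Gh sign"
  by (intro group_hom.intro group_hom_axioms.intro homI)
     (auto simp: carrier_C2 C2_embed_def z_square)

lemma sign_mult:
  "i \<in> carrier C2 \<Longrightarrow> j \<in> carrier C2 \<Longrightarrow> sign (i \<otimes>\<^bsub>C2\<^esub> j) = sign i \<otimes>\<^bsub>Gh\<^esub> sign j"
  using group_hom.hom_mult[OF sign_hom] by blast

lemma sign_inj: "i \<in> carrier C2 \<Longrightarrow> j \<in> carrier C2 \<Longrightarrow> sign i = sign j \<Longrightarrow> i = j"
  using z_nontrivial by (auto simp: carrier_C2 C2_embed_def)

lemma sign_central: "h \<in> carrier Gh \<Longrightarrow> sign j \<otimes>\<^bsub>Gh\<^esub> h = h \<otimes>\<^bsub>Gh\<^esub> sign j"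
  by (simp add: C2_embed_def z_central)

lemma sign_square [simp]: "sign j \<otimes>\<^bsub>Gh\<^esub> sign j = \<one>\<^bsub>Gh\<^esub>"
  by (simp add: C2_embed_def z_square)

lemma fibre_sign:
  assumes "x \<in> carrier Gh" "y \<in> carrier Gh" "\<pi> x = \<pi> y"
  shows "\<exists>j \<in> carrier C2. y = x \<otimes>\<^bsub>Gh\<^esub> sign j"
proof -
  have "\<pi> (inv\<^bsub>Gh\<^esub> x \<otimes>\<^bsub>Gh\<^esub> y) = \<one>\<^bsub>G\<^esub>"
    using assms by simp
  then have "inv\<^bsub>Gh\<^esub> x \<otimes>\<^bsub>Gh\<^esub> y = \<one>\<^bsub>Gh\<^esub> \<or> inv\<^bsub>Gh\<^esub> x \<otimes>\<^bsub>Gh\<^esub> y = z"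
    using assms kernel_cases by simp
  then have "inv\<^bsub>Gh\<^esub> x \<otimes>\<^bsub>Gh\<^esub> y = sign 0 \<or> inv\<^bsub>Gh\<^esub> x \<otimes>\<^bsub>Gh\<^esub> y = sign 1"
    by (simp add: C2_embed_def)
  moreover have "y = x \<otimes>\<^bsub>Gh\<^esub> (inv\<^bsub>Gh\<^esub> x \<otimes>\<^bsub>Gh\<^esub> y)"
    using assms by (simp add: G.m_assoc[symmetric])
  ultimately show ?thesis
    by (metis carrier_C2 insertCI)
qed

lemma eval_word_twist:
  assumes "f \<in> {..<n} \<rightarrow> carrier Gh" "I \<in> {..<n} \<rightarrow> carrier C2" "w \<in> words {..<n}"
  shows "eval_word Gh (\<lambda>l. f l \<otimes>\<^bsub>Gh\<^esub> sign (I l)) w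
    = eval_word Gh f w \<otimes>\<^bsub>Gh\<^esub> sign (eval_word C2 I w)"
proof -
  have "eval_word Gh (\<lambda>l. f l \<otimes>\<^bsub>Gh\<^esub> sign (I l)) w
      = eval_word Gh f w \<otimes>\<^bsub>Gh\<^esub> eval_word Gh (\<lambda>l. sign (I l)) w"
    by (rule G.eval_word_central_mult[OF assms(1) _ assms(3)]) (simp_all add: sign_central)
  then show ?thesis
    using group_hom.eval_word_hom[OF sign_hom assms(2,3)] by simp
qed

text \<open>If a word \<open>w\<close> in the images is trivial, then its value upstairs is \<open>1\<close> or \<open>z\<close>, so \<open>w\<close> or
  \<open>w i\<close> follows from the relators of \<open>P\<^sub>L\<close>. Sending \<open>i\<close> to \<open>1\<close> turns these relators into relations that
  hold in the group presented by \<open>P\<close>, where \<open>w\<close> is therefore trivial.\<close>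

lemma presents_base_of_cover:
  assumes "set R \<subseteq> words {..<n}" "presents (cover_pres n R L) Gh f" "f n = z"
  shows "presents ({..<n}, R) G (\<lambda>l. \<pi> (f l))"
    and "\<And>k. k < length R \<Longrightarrow> eval_word Gh f (R ! k) = sign (L k)"
proof -
  let ?X = "{..<n} \<union> {n}"
  let ?P = "({..<n}, R)" and ?PL = "cover_pres n R L"
  let ?Q = "presented_group ?P"
  have f: "f \<in> ?X \<rightarrow> carrier Gh" and f': "f \<in> {..<n} \<rightarrow> carrier Gh"
    using assms(2) by (auto simp: presents_def)
  have Rw: "set (snd ?P) \<subseteq> words (fst ?P)" using assms(1) by simp
  have words': "w \<in> words ?X" if "w \<in> words {..<n}" for w
    using that by (rule words_mono) blast
  show rel: "eval_word Gh f (R ! k) = sign (L k)" if "k < length R" for k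
    using presents_relator[OF assms(2) cover_pres_words[OF assms(1)]]
      cover_relators_trivial_iff[OF G.is_group assms(1) f, of L] that assms(3) by blast
  have surj: "\<exists>w \<in> words {..<n}. eval_word G (\<lambda>l. \<pi> (f l)) w = g" if g: "g \<in> carrier G" for g
  proof -
    obtain h where h: "h \<in> carrier Gh" "g = \<pi> h" by (rule obtain_lift[OF g])
    then obtain w where w: "w \<in> words ?X" "eval_word Gh f w = h"
      using assms(2) by (auto simp: presents_def)
    let ?w = "filter (\<lambda>(x, b). x \<noteq> n) w"
    have "?w \<in> words {..<n}"
      using filter_words[OF w(1), of n] by (rule words_mono) auto
    moreover have "eval_word G (\<lambda>l. \<pi> (f l)) ?w = g"
      using H.eval_word_filter_trivial[of "\<lambda>l. \<pi> (f l)" ?X w n] eval_word_hom[OF f w(1)] f w h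
      by (simp add: assms(3) Pi_iff)
    ultimately show ?thesis by blast
  qed
  interpret Q: group ?Q by (rule group_presented_group[OF Rw])
  have taut: "presents ?P ?Q (pres_gen ?P)" by (rule presents_presented_group[OF Rw])
  \<comment> \<open>\<open>q\<close> kills the generator \<open>i\<close>, which is the number \<open>n\<close>.\<close>
  define q where "q = (pres_gen ?P)(n := \<one>\<^bsub>?Q\<^esub>)"
  have q: "q \<in> ?X \<rightarrow> carrier ?Q"
    using taut by (auto simp: q_def presents_def)
  have q_eval: "eval_word ?Q q w = eval_word ?Q (pres_gen ?P) w" if "w \<in> words {..<n}" for w
    by (rule eval_word_cong[OF that]) (simp add: q_def)
  have q_rel: "eval_word ?Q q r = \<one>\<^bsub>?Q\<^esub>" if "r \<in> set (snd ?PL)" for r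
  proof -
    have "eval_word ?Q q (R ! k) = \<one>\<^bsub>?Q\<^esub>" if "k < length R" for k
      using presents_relator[OF taut Rw] that assms(1) q_eval by (simp add: subset_iff)
    moreover have "q l \<in> carrier ?Q" if "l < n" for l using q that by auto
    ultimately show ?thesis
      using cover_relators_trivial_iff[OF Q.is_group assms(1) q, of L] that
      by (auto simp: q_def C2_embed_def)
  qed
  have triv: "eval_word G (\<lambda>l. \<pi> (f l)) w = \<one>\<^bsub>G\<^esub> \<longleftrightarrow> consequence ?P w" if w: "w \<in> words {..<n}" for w
  proof
    assume "consequence ?P w"
    moreover have "eval_word G (\<lambda>l. \<pi> (f l)) r = \<one>\<^bsub>G\<^esub>" if r: "r \<in> set R" for r
    proof -
      obtain k where k: "k < length R" "r = R ! k" using r by (auto simp: in_set_conv_nth)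
      have "r \<in> words {..<n}" using r assms(1) by blast
      then show ?thesis
        using eval_word_hom[OF f'] rel[OF k(1)] by (simp add: k(2))
    qed
    ultimately show "eval_word G (\<lambda>l. \<pi> (f l)) w = \<one>\<^bsub>G\<^esub>"
      using H.eval_word_consequence[of "\<lambda>l. \<pi> (f l)" ?P w] w assms(1) f' by (simp add: Pi_iff)
  next
    assume "eval_word G (\<lambda>l. \<pi> (f l)) w = \<one>\<^bsub>G\<^esub>"
    then have "\<pi> (eval_word Gh f w) = \<one>\<^bsub>G\<^esub>"
      using eval_word_hom[OF f' w] by simp
    then have cases: "eval_word Gh f w = \<one>\<^bsub>Gh\<^esub> \<or> eval_word Gh f w = z"
      using kernel_cases G.eval_word_closed[OF f' w] by blast
    define v where "v = (if eval_word Gh f w = \<one>\<^bsub>Gh\<^esub> then w else w @ [(n, True)])"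
    have v: "v \<in> words ?X" using words'[OF w] by (simp add: v_def)
    have "eval_word Gh f v = \<one>\<^bsub>Gh\<^esub>"
    proof (cases "eval_word Gh f w = \<one>\<^bsub>Gh\<^esub>")
      case False
      then have "eval_word Gh f w = z" using cases by blast
      then show ?thesis
        using G.eval_word_append[OF f, of w "[(n, True)]"] words'[OF w] z_nontrivial
        by (simp add: v_def assms(3) z_square)
    qed (simp add: v_def)
    then have "consequence ?PL v"
      using assms(2) v by (simp add: presents_def)
    then have "eval_word ?Q q v = \<one>\<^bsub>?Q\<^esub>"
      using Q.eval_word_consequence[of q ?PL v] q q_rel v cover_pres_words[OF assms(1)] by simp
    moreover have "eval_word ?Q q v = eval_word ?Q q w"
      using Q.eval_word_append[OF q, of w "[(n, True)]"] words'[OF w] Q.eval_word_closed[OF q]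
      by (simp add: v_def q_def)
    ultimately show "consequence ?P w"
      using taut w q_eval[OF w] by (simp add: presents_def)
  qed
  show "presents ?P G (\<lambda>l. \<pi> (f l))"
    using surj triv f' by (simp add: presents_def Pi_iff)
qed


text \<open>The only hard point is that a word that is trivial in \<open>Gh\<close> follows from the relators of \<open>P\<^sub>L\<close>.
  Its image in \<open>G\<close> is trivial, so after deletion of \<open>i\<close> it follows from \<open>R\<close>. Modulo \<open>i\<close> the relators
  of \<open>P\<^sub>L\<close> are \<open>R\<close>, so in the group presented by \<open>P\<^sub>L\<close> the word is \<open>1\<close> or \<open>i\<close>. The value \<open>i\<close> is
  impossible since it goes to \<open>z \<noteq> 1\<close> in \<open>Gh\<close>.\<close>

lemma presents_cover:
  assumes "set R \<subseteq> words {..<n}" "f \<in> {..<n} \<rightarrow> carrier Gh" "f n = z"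
    and base: "presents ({..<n}, R) G (\<lambda>l. \<pi> (f l))"
    and rel: "\<And>k. k < length R \<Longrightarrow> eval_word Gh f (R ! k) = sign (L k)"
  shows "presents (cover_pres n R L) Gh f"
proof -
  let ?X = "{..<n} \<union> {n}"
  let ?P = "({..<n}, R)" and ?PL = "cover_pres n R L"
  let ?Q = "presented_group ?PL" and ?q = "pres_gen ?PL"
  let ?Z = "{\<one>\<^bsub>?Q\<^esub>, ?q n}"
  have f: "f \<in> ?X \<rightarrow> carrier Gh" using assms(2,3) by auto
  note PLw = cover_pres_words[OF assms(1), of L]
  interpret Q: group ?Q by (rule group_presented_group[OF PLw])
  have taut: "presents ?PL ?Q ?q" by (rule presents_presented_group[OF PLw])
  then have q: "?q \<in> ?X \<rightarrow> carrier ?Q" by (simp add: presents_def)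
  then have qn: "?q n \<in> carrier ?Q" by auto
  have qrel: "\<And>k. k < length R \<Longrightarrow> eval_word ?Q ?q (R ! k) = C2_embed ?Q (?q n) (L k)"
    and qsq: "?q n \<otimes>\<^bsub>?Q\<^esub> ?q n = \<one>\<^bsub>?Q\<^esub>"
    and qcomm: "\<And>l. l < n \<Longrightarrow> ?q n \<otimes>\<^bsub>?Q\<^esub> ?q l = ?q l \<otimes>\<^bsub>?Q\<^esub> ?q n"
    using presents_relator[OF taut PLw]
      cover_relators_trivial_iff[OF Q.is_group assms(1) q, of L] by blast+
  have qcentral: "?q n \<otimes>\<^bsub>?Q\<^esub> h = h \<otimes>\<^bsub>?Q\<^esub> ?q n" if h: "h \<in> carrier ?Q" for h
  proof -
    obtain w where "w \<in> words ?X" "eval_word ?Q ?q w = h"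
      using taut h by (auto simp: presents_def)
    then show ?thesis
      using Q.eval_word_centralizes[OF q _ qn] qcomm by auto
  qed
  have "?Z \<lhd> ?Q"
  proof (rule Q.normal_invI)
    have "inv\<^bsub>?Q\<^esub> (?q n) = ?q n"
      using qsq qn by (metis Q.inv_equality)
    then show "subgroup ?Z ?Q"
      using qn qsq by (intro Q.subgroupI) auto
  next
    fix x h assume "x \<in> carrier ?Q" "h \<in> ?Z"
    then have "h \<in> carrier ?Q" "x \<otimes>\<^bsub>?Q\<^esub> h = h \<otimes>\<^bsub>?Q\<^esub> x"
      using qn qcentral[of x] Q.r_one Q.l_one Q.one_closed by (metis insertE singletonD)+
    then have "x \<otimes>\<^bsub>?Q\<^esub> h \<otimes>\<^bsub>?Q\<^esub> inv\<^bsub>?Q\<^esub> x = h"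
      using \<open>x \<in> carrier ?Q\<close> by (simp add: Q.m_assoc)
    then show "x \<otimes>\<^bsub>?Q\<^esub> h \<otimes>\<^bsub>?Q\<^esub> inv\<^bsub>?Q\<^esub> x \<in> ?Z"
      using \<open>h \<in> ?Z\<close> by simp
  qed
  then interpret Z: normal ?Z ?Q .
  define \<kappa> where "\<kappa> = (\<lambda>h. ?Z #>\<^bsub>?Q\<^esub> h)"
  interpret \<kappa>: group_hom ?Q "?Q Mod ?Z" \<kappa>
    unfolding \<kappa>_def
    by (intro group_hom.intro group_hom_axioms.intro Q.is_group Z.factorgroup_is_group
        Z.r_coset_hom_Mod)
  have \<kappa>_one: "\<kappa> h = \<one>\<^bsub>?Q Mod ?Z\<^esub> \<longleftrightarrow> h \<in> ?Z" if "h \<in> carrier ?Q" for h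
    using that Q.coset_join1[OF _ that Z.subgroup_axioms] Q.coset_join2[OF that Z.subgroup_axioms]
    by (auto simp: \<kappa>_def FactGroup_def)
  have \<kappa>q: "(\<lambda>x. \<kappa> (?q x)) \<in> ?X \<rightarrow> carrier (?Q Mod ?Z)"
    using q by (simp add: Pi_iff)
  have \<kappa>q': "(\<lambda>x. \<kappa> (?q x)) \<in> {..<n} \<rightarrow> carrier (?Q Mod ?Z)"
    using \<kappa>q by simp
  have fw: "(\<lambda>x. \<pi> (f x)) \<in> ?X \<rightarrow> carrier G"
    using f by (simp add: Pi_iff)
  have trivial: "\<forall>r \<in> set (snd ?PL). eval_word Gh f r = \<one>\<^bsub>Gh\<^esub>"
    unfolding cover_relators_trivial_iff[OF G.is_group assms(1) f] assms(3)
    using rel z_square z_central PiE[OF assms(2)] by blast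
  have sound: "eval_word Gh f w = \<one>\<^bsub>Gh\<^esub>" if "consequence ?PL w" "w \<in> words ?X" for w
    using G.eval_word_consequence[of f ?PL w] f PLw trivial that by simp
  have complete: "consequence ?PL w" if w: "w \<in> words ?X" and 1: "eval_word Gh f w = \<one>\<^bsub>Gh\<^esub>" for w
  proof -
    let ?w = "filter (\<lambda>(x, b). x \<noteq> n) w"
    have w': "?w \<in> words {..<n}"
      using filter_words[OF w, of n] by (rule words_mono) auto
    have "eval_word G (\<lambda>l. \<pi> (f l)) ?w = \<one>\<^bsub>G\<^esub>"
      using H.eval_word_filter_trivial[OF fw w, of n] eval_word_hom[OF f w] 1
      by (simp add: assms(3))
    then have cons: "consequence ?P ?w"
      using base w' by (simp add: presents_def)
    have "eval_word (?Q Mod ?Z) (\<lambda>x. \<kappa> (?q x)) r = \<one>\<^bsub>?Q Mod ?Z\<^esub>" if r: "r \<in> set R" for r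
    proof -
      obtain k where k: "k < length R" "r = R ! k" using r by (auto simp: in_set_conv_nth)
      have "r \<in> words {..<n}" using r assms(1) by blast
      then have rX: "r \<in> words ?X" by (rule words_mono) blast
      have "eval_word ?Q ?q r \<in> ?Z"
        using qrel[OF k(1)] by (simp add: k(2) C2_embed_def)
      then show ?thesis
        using \<kappa>.eval_word_hom[OF q rX] \<kappa>_one[OF Q.eval_word_closed[OF q rX]] by simp
    qed
    then have "eval_word (?Q Mod ?Z) (\<lambda>x. \<kappa> (?q x)) ?w = \<one>\<^bsub>?Q Mod ?Z\<^esub>"
      using \<kappa>.H.eval_word_consequence[of "\<lambda>x. \<kappa> (?q x)" ?P ?w] \<kappa>q' assms(1) cons w' by simp
    moreover have "\<kappa> (?q n) = \<one>\<^bsub>?Q Mod ?Z\<^esub>"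
      using \<kappa>_one[OF qn] by simp
    ultimately have "\<kappa> (eval_word ?Q ?q w) = \<one>\<^bsub>?Q Mod ?Z\<^esub>"
      using \<kappa>.H.eval_word_filter_trivial[OF \<kappa>q w, of n] \<kappa>.eval_word_hom[OF q w] by simp
    then have "eval_word ?Q ?q w = \<one>\<^bsub>?Q\<^esub> \<or> eval_word ?Q ?q w = ?q n"
      using \<kappa>_one[OF Q.eval_word_closed[OF q w]] by simp
    moreover have "eval_word ?Q ?q w \<noteq> ?q n"
    proof
      assume "eval_word ?Q ?q w = ?q n"
      then have "eval_word ?Q ?q (w @ [(n, True)]) = \<one>\<^bsub>?Q\<^esub>"
        using Q.eval_word_append[OF q w, of "[(n, True)]"] qn qsq by simp
      then have "eval_word Gh f (w @ [(n, True)]) = \<one>\<^bsub>Gh\<^esub>"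
        using sound[of "w @ [(n, True)]"] taut w by (simp add: presents_def)
      then show False
        using G.eval_word_append[OF f w, of "[(n, True)]"] 1 z_nontrivial by (simp add: assms(3))
    qed
    ultimately show ?thesis
      using taut w by (simp add: presents_def)
  qed
  have "\<exists>w \<in> words ?X. eval_word Gh f w = h" if h: "h \<in> carrier Gh" for h
  proof -
    obtain w where w: "w \<in> words {..<n}" "eval_word G (\<lambda>l. \<pi> (f l)) w = \<pi> h"
      using base hom_closed[OF h] by (auto simp: presents_def)
    have wX: "w \<in> words ?X" by (rule words_mono[OF w(1)]) blast
    have "\<pi> (eval_word Gh f w) = \<pi> h"
      using eval_word_hom[OF f wX] w(2) by simp
    then obtain j where j: "h = eval_word Gh f w \<otimes>\<^bsub>Gh\<^esub> sign j"
      using fibre_sign[OF G.eval_word_closed[OF f wX] h] by blast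
    have "eval_word Gh f (w @ C2_word n j) = h"
      using G.eval_word_append[OF f wX, of "C2_word n j"]
      by (simp add: j C2_word_def C2_embed_def assms(3))
    then show ?thesis
      using wX by (intro bexI[of _ "w @ C2_word n j"]) (auto simp: C2_word_def)
  qed
  then show ?thesis
    using f sound complete by (auto simp: presents_def simp del: Un_insert_right)
qed

lemma is_cover_presentation_of_iff:
  assumes "set R \<subseteq> words {..<n}"
  shows "is_cover_presentation_of n R L Gh z \<longleftrightarrow> (\<exists>f. f n = z \<and> presents (cover_pres n R L) Gh f)"
proof
  assume "is_cover_presentation_of n R L Gh z"
  then obtain \<phi> where \<phi>: "\<phi> \<in> iso (presented_group (cover_pres n R L)) Gh"
    "\<phi> (pres_gen (cover_pres n R L) n) = z"
    by (auto simp: is_cover_presentation_of_def)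
  have presents: "presents (cover_pres n R L) Gh (\<lambda>x. \<phi> (pres_gen (cover_pres n R L) x))"
    by (rule iffD2[OF presents_iff_iso[OF G.is_group cover_pres_words[OF assms]]],
        rule bexI[OF _ \<phi>(1)]) simp
  show "\<exists>f. f n = z \<and> presents (cover_pres n R L) Gh f"
    by (rule exI[where x = "\<lambda>x. \<phi> (pres_gen (cover_pres n R L) x)"])
       (rule conjI[OF \<phi>(2) presents])
next
  assume "\<exists>f. f n = z \<and> presents (cover_pres n R L) Gh f"
  then obtain f where f: "f n = z" "presents (cover_pres n R L) Gh f" by blast
  obtain \<phi> where "\<phi> \<in> iso (presented_group (cover_pres n R L)) Gh"
    "\<And>x. x \<in> {..<n} \<union> {n} \<Longrightarrow> \<phi> (pres_gen (cover_pres n R L) x) = f x"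
    using presents_iff_iso[OF G.is_group cover_pres_words[OF assms], of L f] f(2) by auto
  then show "is_cover_presentation_of n R L Gh z"
    using f(1) unfolding is_cover_presentation_of_def by auto
qed

section \<open>Lifting automorphisms\<close>

lemma double_covering_pi: "double_covering Gh G \<pi>"
  using onto kernel_eq z_nontrivial
  by (simp add: double_covering_def epi_def)

lemma aut_fixes_z:
  assumes "characteristic_subgroup (kernel Gh G \<pi>) Gh" "\<psi> \<in> carrier (AutoGroup Gh)"
  shows "\<psi> z = z"
proof -
  interpret \<psi>: group_hom Gh Gh \<psi>
    using assms(2) by (intro group_hom.intro group_hom_axioms.intro) (simp_all add: AutoGroup_iff iso_def)
  have "\<psi> z \<in> {\<one>\<^bsub>Gh\<^esub>, z}"
    using assms kernel_eq unfolding characteristic_subgroup_def by blast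
  moreover have "\<psi> z \<noteq> \<one>\<^bsub>Gh\<^esub>"
    using \<psi>.iso_iff assms(2) z_nontrivial by (auto simp: AutoGroup_iff)
  ultimately show ?thesis by blast
qed

text \<open>The induced map is injective because \<open>\<psi>\<close> fixes \<open>z\<close>, so that only kernel elements are mapped into
  the kernel.\<close>

lemma induced_aut_closed:
  assumes "characteristic_subgroup (kernel Gh G \<pi>) Gh" "\<psi> \<in> carrier (AutoGroup Gh)"
  shows "induced_aut Gh G \<pi> \<psi> \<in> carrier (AutoGroup G)"
proof -
  have \<psi>: "\<psi> \<in> iso Gh Gh" using assms(2) by (simp add: AutoGroup_iff)
  interpret \<psi>: group_hom Gh Gh \<psi>
    using \<psi> by (intro group_hom.intro group_hom_axioms.intro) (simp_all add: iso_def)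
  note ind = induced_aut_apply[OF double_covering_pi assms]
  have "induced_aut Gh G \<pi> \<psi> \<in> hom G G"
  proof (rule homI)
    fix a b assume "a \<in> carrier G" "b \<in> carrier G"
    then obtain x y where xy: "x \<in> carrier Gh" "y \<in> carrier Gh" "a = \<pi> x" "b = \<pi> y"
      by (metis obtain_lift)
    then show "induced_aut Gh G \<pi> \<psi> a \<in> carrier G"
      by (simp add: ind)
    have "induced_aut Gh G \<pi> \<psi> (\<pi> (x \<otimes>\<^bsub>Gh\<^esub> y)) = \<pi> (\<psi> (x \<otimes>\<^bsub>Gh\<^esub> y))"
      using xy by (intro ind) simp
    then show "induced_aut Gh G \<pi> \<psi> (a \<otimes>\<^bsub>G\<^esub> b)
        = induced_aut Gh G \<pi> \<psi> a \<otimes>\<^bsub>G\<^esub> induced_aut Gh G \<pi> \<psi> b"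
      using xy by (simp add: ind)
  qed
  then interpret ind: group_hom G G "induced_aut Gh G \<pi> \<psi>"
    by (intro group_hom.intro group_hom_axioms.intro H.is_group)
  have "\<psi> ` carrier Gh = carrier Gh"
    using \<psi> by (simp add: iso_def bij_betw_def)
  have "carrier G \<subseteq> induced_aut Gh G \<pi> \<psi> ` carrier G"
  proof
    fix a assume "a \<in> carrier G"
    then obtain y where y: "y \<in> carrier Gh" "a = \<pi> y" by (rule obtain_lift)
    then obtain x where "x \<in> carrier Gh" "y = \<psi> x"
      using \<open>\<psi> ` carrier Gh = carrier Gh\<close> by blast
    then show "a \<in> induced_aut Gh G \<pi> \<psi> ` carrier G"
      using y ind[of x] by (intro image_eqI[of _ _ "\<pi> x"]) simp_all
  qed
  moreover have "a = \<one>\<^bsub>G\<^esub>" if a: "a \<in> carrier G" "induced_aut Gh G \<pi> \<psi> a = \<one>\<^bsub>G\<^esub>" for a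
  proof -
    obtain x where x: "x \<in> carrier Gh" "a = \<pi> x" by (rule obtain_lift[OF a(1)])
    then have "\<psi> x = \<one>\<^bsub>Gh\<^esub> \<or> \<psi> x = \<psi> z"
      using a ind[of x] kernel_cases[of "\<psi> x"] aut_fixes_z[OF assms] by simp
    moreover have "inj_on \<psi> (carrier Gh)"
      using \<psi> by (simp add: iso_def bij_betw_def)
    moreover have "\<psi> x = \<one>\<^bsub>Gh\<^esub> \<Longrightarrow> x = \<one>\<^bsub>Gh\<^esub>"
      using \<psi>.iso_iff \<psi> x(1) by blast
    ultimately have "x = \<one>\<^bsub>Gh\<^esub> \<or> x = z"
      using x(1) inj_onD[of \<psi> "carrier Gh" x z] by auto
    then show ?thesis using x(2) by auto
  qed
  ultimately have "induced_aut Gh G \<pi> \<psi> \<in> iso G G"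
    using ind.iso_iff by blast
  then show ?thesis
    by (simp add: AutoGroup_iff induced_aut_def)
qed

text \<open>Both \<open>\<pi> f\<close> and \<open>\<pi> g\<close> are generators of \<open>G\<close> on which \<open>P\<close> is a presentation, so an automorphism
  \<open>\<theta>\<close> carries the first to the second. It is induced by some \<open>\<psi>\<close>, and \<open>g\<close> differs from \<open>\<psi> f\<close>, whose
  relator values are given by \<open>J\<close>, by powers of \<open>z\<close>.\<close>

lemma strong_imp_cover_equiv:
  assumes strong: "strong_double_covering Gh G \<pi>" and R: "set R \<subseteq> words {..<n}"
    and J: "J \<in> carrier (C2_pow (length R))" "is_cover_presentation_of n R J Gh z"
    and L: "L \<in> carrier (C2_pow (length R))" "is_cover_presentation_of n R L Gh z"
  shows "cover_equiv n R J L"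
proof -
  obtain f where fn: "f n = z" and f: "presents (cover_pres n R J) Gh f"
    using J(2) is_cover_presentation_of_iff[OF R] by blast
  obtain g where gn: "g n = z" and g: "presents (cover_pres n R L) Gh g"
    using L(2) is_cover_presentation_of_iff[OF R] by blast
  have f_closed: "f \<in> {..<n} \<rightarrow> carrier Gh" and g_closed: "g \<in> {..<n} \<rightarrow> carrier Gh"
    using f g by (auto simp: presents_def)
  note fb = presents_base_of_cover[OF R f fn] and gb = presents_base_of_cover[OF R g gn]
  obtain \<theta> where \<theta>: "\<theta> \<in> carrier (AutoGroup G)" "\<And>l. l < n \<Longrightarrow> \<theta> (\<pi> (f l)) = \<pi> (g l)"
    using presents_aut[OF H.is_group _ fb(1) gb(1)] R by auto
  have char: "characteristic_subgroup (kernel Gh G \<pi>) Gh"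
    using strong by (simp add: strong_double_covering_def)
  obtain \<psi> where \<psi>: "\<psi> \<in> carrier (AutoGroup Gh)" "\<theta> = induced_aut Gh G \<pi> \<psi>"
    using \<theta>(1) strong unfolding strong_double_covering_def by blast
  interpret \<psi>: group_hom Gh Gh \<psi>
    using \<psi>(1) by (intro group_hom.intro group_hom_axioms.intro) (simp_all add: AutoGroup_iff iso_def)
  have "\<exists>j \<in> carrier C2. g l = \<psi> (f l) \<otimes>\<^bsub>Gh\<^esub> sign j" if l: "l < n" for l
  proof (rule fibre_sign)
    have "f l \<in> carrier Gh" using f_closed l by auto
    then show "\<psi> (f l) \<in> carrier Gh" "\<pi> (\<psi> (f l)) = \<pi> (g l)"
      using \<theta>(2)[OF l] induced_aut_apply[OF double_covering_pi char \<psi>(1)] by (simp_all add: \<psi>(2))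
    show "g l \<in> carrier Gh" using g_closed l by auto
  qed
  then obtain s where s: "\<And>l. l < n \<Longrightarrow> s l \<in> carrier C2 \<and> g l = \<psi> (f l) \<otimes>\<^bsub>Gh\<^esub> sign (s l)"
    by metis
  define I where "I = restrict s {..<n}"
  have I: "I \<in> carrier (C2_pow n)" "I \<in> {..<n} \<rightarrow> carrier C2"
    using s by (simp_all add: I_def)
  have "L k = eval_word C2 I (R ! k) \<otimes>\<^bsub>C2\<^esub> J k" if k: "k < length R" for k
  proof -
    interpret C: group C2 by simp
    have w: "R ! k \<in> words {..<n}" using R nth_mem[OF k] by blast
    have e: "eval_word C2 I (R ! k) \<in> carrier C2" by (rule C.eval_word_closed[OF I(2) w])
    have Jk: "J k \<in> carrier C2" and Lk: "L k \<in> carrier C2"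
      using J(1) L(1) k by auto
    have "sign (L k) = eval_word Gh g (R ! k)"
      using gb(2)[OF k] by simp
    also have "\<dots> = eval_word Gh (\<lambda>l. \<psi> (f l) \<otimes>\<^bsub>Gh\<^esub> sign (I l)) (R ! k)"
      by (rule eval_word_cong[OF w]) (use s in \<open>simp add: I_def\<close>)
    also have "\<dots> = eval_word Gh (\<lambda>l. \<psi> (f l)) (R ! k) \<otimes>\<^bsub>Gh\<^esub> sign (eval_word C2 I (R ! k))"
      by (rule eval_word_twist[OF _ I(2) w]) (use f_closed in \<open>simp add: Pi_iff\<close>)
    also have "eval_word Gh (\<lambda>l. \<psi> (f l)) (R ! k) = \<psi> (sign (J k))"
      using \<psi>.eval_word_hom[OF f_closed w] fb(2)[OF k] by simp
    also have "\<psi> (sign (J k)) = sign (J k)"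
      using aut_fixes_z[OF char \<psi>(1)] by (simp add: C2_embed_def)
    also have "sign (J k) \<otimes>\<^bsub>Gh\<^esub> sign (eval_word C2 I (R ! k)) = sign (eval_word C2 I (R ! k) \<otimes>\<^bsub>C2\<^esub> J k)"
      unfolding sign_mult[OF e Jk] by (rule sign_central) simp
    finally show ?thesis
      using sign_inj[OF Lk C.m_closed[OF e Jk]] by blast
  qed
  then show ?thesis
    using cover_equiv_iff[OF L(1)] I(1) by blast
qed

text \<open>The relator values of an arbitrary lift \<open>a\<close> of \<open>\<theta> (\<pi> f)\<close> define an \<open>L\<close> for which \<open>P\<^sub>L\<close> presents
  \<open>Gh\<close>. By uniqueness \<open>L\<close> is equivalent to \<open>J\<close>, which yields the correction of \<open>a\<close> to a lift \<open>g\<close> with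
  relator values \<open>J\<close>.\<close>

lemma unique_class_imp_strong:
  assumes char: "characteristic_subgroup (kernel Gh G \<pi>) Gh" and R: "set R \<subseteq> words {..<n}"
    and J: "J \<in> carrier (C2_pow (length R))" "is_cover_presentation_of n R J Gh z"
    and unique: "\<And>L. L \<in> carrier (C2_pow (length R)) \<Longrightarrow>
      is_cover_presentation_of n R L Gh z \<Longrightarrow> cover_equiv n R J L"
  shows "strong_double_covering Gh G \<pi>"
proof -
  obtain f where fn: "f n = z" and f: "presents (cover_pres n R J) Gh f"
    using J(2) is_cover_presentation_of_iff[OF R] by blast
  have f_closed: "f \<in> {..<n} \<rightarrow> carrier Gh"
    using f by (auto simp: presents_def)
  note fb = presents_base_of_cover[OF R f fn]
  have "\<theta> \<in> induced_aut Gh G \<pi> ` carrier (AutoGroup Gh)" if \<theta>: "\<theta> \<in> carrier (AutoGroup G)" for \<theta>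
  proof -
    have \<theta>_iso: "\<theta> \<in> iso G G" using \<theta> by (simp add: AutoGroup_iff)
    then have \<theta>_hom: "\<theta> \<in> hom G G" by (simp add: iso_def)
    have "\<exists>y \<in> carrier Gh. \<pi> y = \<theta> (\<pi> (f l))" if l: "l < n" for l
    proof -
      have "\<theta> (\<pi> (f l)) \<in> carrier G"
        using f_closed l \<theta>_hom by (auto simp: hom_def Pi_iff)
      then show ?thesis by (metis obtain_lift)
    qed
    then obtain y where y: "\<And>l. l < n \<Longrightarrow> y l \<in> carrier Gh \<and> \<pi> (y l) = \<theta> (\<pi> (f l))"
      by metis
    define a where "a = y(n := z)"
    have a: "a \<in> {..<n} \<rightarrow> carrier Gh" "a n = z" "\<And>l. l < n \<Longrightarrow> \<pi> (a l) = \<theta> (\<pi> (f l))"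
      using y by (auto simp: a_def)
    have base: "presents ({..<n}, R) G (\<lambda>l. \<pi> (a l))"
      using presents_transport_iso[OF fb(1) \<theta>_iso H.is_group H.is_group]
        presents_cong[of "({..<n}, R)" "\<lambda>l. \<pi> (a l)" "\<lambda>l. \<theta> (\<pi> (f l))" G] a(3) by simp
    have w: "R ! k \<in> words {..<n}" if "k < length R" for k using R nth_mem[OF that] by blast
    have "\<exists>j \<in> carrier C2. eval_word Gh a (R ! k) = \<one>\<^bsub>Gh\<^esub> \<otimes>\<^bsub>Gh\<^esub> sign j" if k: "k < length R" for k
    proof (rule fibre_sign)
      show "eval_word Gh a (R ! k) \<in> carrier Gh"
        by (rule G.eval_word_closed[OF a(1) w[OF k]])
      have "eval_word G (\<lambda>l. \<pi> (a l)) (R ! k) = \<one>\<^bsub>G\<^esub>"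
        using presents_relator[OF base] R k by simp
      then show "\<pi> \<one>\<^bsub>Gh\<^esub> = \<pi> (eval_word Gh a (R ! k))"
        using eval_word_hom[OF a(1) w[OF k]] by simp
    qed simp
    then obtain M where M: "\<And>k. k < length R \<Longrightarrow> M k \<in> carrier C2 \<and> eval_word Gh a (R ! k) = sign (M k)"
      by (metis G.l_one sign_closed)
    define L where "L = restrict M {..<length R}"
    have L: "L \<in> carrier (C2_pow (length R))" "\<And>k. k < length R \<Longrightarrow> eval_word Gh a (R ! k) = sign (L k)"
      using M by (simp_all add: L_def)
    have "presents (cover_pres n R L) Gh a"
      by (rule presents_cover[OF R a(1,2) base L(2)])
    then have "cover_equiv n R J L"
      using unique[OF L(1)] is_cover_presentation_of_iff[OF R] a(2) by blast
    then obtain I where I: "I \<in> carrier (C2_pow n)"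
      and LJ: "\<And>k. k < length R \<Longrightarrow> L k = eval_word C2 I (R ! k) \<otimes>\<^bsub>C2\<^esub> J k"
      using cover_equiv_iff[OF L(1)] by blast
    have I': "I \<in> {..<n} \<rightarrow> carrier C2" using I by auto
    \<comment> \<open>The same \<open>I\<close> leads from \<open>L\<close> back to \<open>J\<close>, because every element of \<open>C\<^sub>2\<close> is its own inverse.\<close>
    define g where "g = (\<lambda>l. a l \<otimes>\<^bsub>Gh\<^esub> sign (I l))(n := z)"
    have "\<pi> (g l) = \<pi> (a l)" if "l < n" for l
      using a(1) that by (simp add: g_def Pi_iff)
    then have g: "g \<in> {..<n} \<rightarrow> carrier Gh" "g n = z" "\<And>l. l < n \<Longrightarrow> \<pi> (g l) = \<theta> (\<pi> (f l))"
      using a by (auto simp: g_def Pi_iff)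
    have "presents ({..<n}, R) G (\<lambda>l. \<pi> (g l))"
      using base presents_cong[of "({..<n}, R)" "\<lambda>l. \<pi> (g l)" "\<lambda>l. \<pi> (a l)" G] a(3) g(3) by simp
    moreover have "eval_word Gh g (R ! k) = sign (J k)" if k: "k < length R" for k
    proof -
      interpret C: group C2 by simp
      have e: "eval_word C2 I (R ! k) \<in> carrier C2" by (rule C.eval_word_closed[OF I' w[OF k]])
      have Jk: "J k \<in> carrier C2" using J(1) k by auto
      have "eval_word Gh g (R ! k) = eval_word Gh (\<lambda>l. a l \<otimes>\<^bsub>Gh\<^esub> sign (I l)) (R ! k)"
        by (rule eval_word_cong[OF w[OF k]]) (simp add: g_def)
      also have "\<dots> = sign (L k) \<otimes>\<^bsub>Gh\<^esub> sign (eval_word C2 I (R ! k))"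
        using eval_word_twist[OF a(1) I' w[OF k]] L(2)[OF k] by simp
      also have "\<dots> = sign (eval_word C2 I (R ! k)) \<otimes>\<^bsub>Gh\<^esub> sign (L k)"
        by (rule sign_central[symmetric]) simp
      also have "\<dots> = sign (J k)"
        unfolding LJ[OF k] sign_mult[OF e Jk] by (simp add: G.m_assoc[symmetric])
      finally show ?thesis .
    qed
    ultimately have "presents (cover_pres n R J) Gh g"
      by (rule presents_cover[OF R g(1,2)])
    then obtain \<psi> where \<psi>: "\<psi> \<in> carrier (AutoGroup Gh)" "\<And>x. x \<in> {..<n} \<union> {n} \<Longrightarrow> \<psi> (f x) = g x"
      using presents_aut[OF G.is_group cover_pres_words[OF R] f] by (metis fst_cover_pres)
    have ind: "induced_aut Gh G \<pi> \<psi> \<in> carrier (AutoGroup G)"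
      by (rule induced_aut_closed[OF char \<psi>(1)])
    have agree: "induced_aut Gh G \<pi> \<psi> (\<pi> (f l)) = \<theta> (\<pi> (f l))" if l: "l < n" for l
    proof -
      have "f l \<in> carrier Gh" using f_closed l by auto
      then show ?thesis
        using induced_aut_apply[OF double_covering_pi char \<psi>(1)] \<psi>(2)[of l] g(3)[OF l] l by simp
    qed
    have "induced_aut Gh G \<pi> \<psi> x = \<theta> x" if x: "x \<in> carrier G" for x
    proof (rule presents_hom_eq[OF fb(1) H.is_group H.is_group _ \<theta>_hom _ x])
      show "induced_aut Gh G \<pi> \<psi> \<in> hom G G"
        using ind by (simp add: AutoGroup_iff iso_def)
    qed (use agree in simp)
    then have "induced_aut Gh G \<pi> \<psi> = \<theta>"
      using ind \<theta> by (intro extensionalityI[of _ "carrier G"]) (simp_all add: AutoGroup_iff)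
    then show ?thesis using \<psi>(1) by blast
  qed
  then show ?thesis
    using char double_covering_pi induced_aut_closed[OF char]
    unfolding strong_double_covering_def by blast
qed

end

lemma pointed_double_coveringI:
  assumes "double_covering Gh G \<pi>" "z \<in> kernel Gh G \<pi>" "z \<noteq> \<one>\<^bsub>Gh\<^esub>"
  shows "pointed_double_covering Gh G \<pi> z"
proof -
  have "group Gh" "group G" "\<pi> \<in> hom Gh G" "\<pi> ` carrier Gh = carrier G"
    and card: "card (kernel Gh G \<pi>) = 2"
    using assms(1) unfolding double_covering_def epi_def by blast+
  then interpret group_hom Gh G \<pi>
    by (simp add: group_hom_def group_hom_axioms_def)
  have "\<one>\<^bsub>Gh\<^esub> \<in> kernel Gh G \<pi>" by (simp add: kernel_def)
  then have "{\<one>\<^bsub>Gh\<^esub>, z} = kernel Gh G \<pi>"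
    using card assms(2,3) card_ge_0_finite[of "kernel Gh G \<pi>"]
    by (intro card_subset_eq) simp_all
  then show ?thesis
    using assms(3) \<open>\<pi> ` carrier Gh = carrier G\<close> by unfold_locales simp_all
qed

theorem theorem13:
  fixes Gh :: "('a, 'c) monoid_scheme"
    and G :: "('b, 'd) monoid_scheme"
    and \<pi> :: "'a \<Rightarrow> 'b"
    and z :: 'a
    and n m :: nat
    and R :: "nat word list"
    and J :: "nat \<Rightarrow> int"
  assumes covering: "double_covering Gh G \<pi>"
    and kernel_char: "characteristic_subgroup (kernel Gh G \<pi>) Gh"
    and z: "z \<in> kernel Gh G \<pi>" "z \<noteq> \<one>\<^bsub>Gh\<^esub>"
    and relators: "set R \<subseteq> words {..<n}" "length R = m"
    and presentation: "is_presentation_of ({..<n}, R) G"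
    and J: "J \<in> carrier (C2_pow m)" "J \<noteq> \<one>\<^bsub>C2_pow m\<^esub>"
    and cover_presentation: "is_cover_presentation_of n R J Gh z"
  shows "(strong_double_covering Gh G \<pi> \<longleftrightarrow> pres_classes_of n R Gh z = {pres_class n R J}) \<and>
    (strong_double_covering Gh G \<pi> \<longleftrightarrow>
       (\<forall>L \<in> carrier (C2_pow m). is_cover_presentation_of n R L Gh z \<longrightarrow>
          L \<in> (relator_values R ` carrier (C2_pow n)) #>\<^bsub>C2_pow m\<^esub> J))"
proof -
  interpret pointed_double_covering Gh G \<pi> z
    by (rule pointed_double_coveringI[OF covering z])
  have J': "J \<in> carrier (C2_pow (length R))" using J(1) relators(2) by simp
  have strong_iff: "strong_double_covering Gh G \<pi> \<longleftrightarrow>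
      (\<forall>L \<in> carrier (C2_pow (length R)). is_cover_presentation_of n R L Gh z \<longrightarrow> cover_equiv n R J L)"
    using strong_imp_cover_equiv[OF _ relators(1) J' cover_presentation]
      unique_class_imp_strong[OF kernel_char relators(1) J' cover_presentation] by blast
  also have "\<dots> \<longleftrightarrow> (\<forall>L \<in> carrier (C2_pow (length R)). is_cover_presentation_of n R L Gh z \<longrightarrow>
      pres_class n R L = pres_class n R J)"
    using pres_class_eq_iff[OF relators(1) J'] by blast
  also have "\<dots> \<longleftrightarrow> pres_classes_of n R Gh z = {pres_class n R J}"
    unfolding pres_classes_of_def using J' cover_presentation by blast
  finally show ?thesis
    using strong_iff unfolding relators(2)[symmetric] cover_equiv_def by blast
qed

end
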